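(* Let $\mathrm{M}$ be a matroid on a finite ground set $E$, let $\mathrm{N}$ be a matroid on a finite ground set $F$, and let $f:\mathrm{M}\to\mathrm{N}$ be a morphism of matroids. Let $n=|E|$ and let $w=(w_i)_{i\in E}$ be the coordinate functions on $\mathbb{R}^E\simeq\mathbb{R}^n$. Then the basis generating polynomial $$\underline{\mathrm{B}}_f(w):=\sum_{S\in\mathscr{B}(f)}\ \prod_{i\in S}w_i$$ is either identically zero or its logarithm is concave on the positive orthant $\mathbb{R}^{n}_{>0}$.
   Context: A matroid $\mathrm{M}$ on a finite set $E$ is given by its rank function $\operatorname{rk}_{\mathrm{M}}:2^E\to\mathbb{N}$ (with $\operatorname{rk}_{\mathrm M}(S)\le|S|$, monotone, submodular). A basis of $\mathrm{M}$ is a subset $S$ with $\operatorname{rk}_{\mathrm M}(S)=|S|=\operatorname{rk}_{\mathrm M}(E)$. A morphism $f:\mathrm{M}\to\mathrm{N}$ between matroids $\mathrm{M}$ on $E$ and $\mathrm{N}$ on $F$ is a function $f:E\to F$ such that $\operatorname{rk}_{\mathrm{N}}(f(S_2))-\operatorname{rk}_{\mathrm{N}}(f(S_1))\le\operatorname{rk}_{\mathrm{M}}(S_2)-\operatorname{rk}_{\mathrm{M}}(S_1)$ for all $S_1\subseteq S_2\subseteq E$. A subset $S\subseteq E$ is a basis of $f$ if $S$ is contained in a basis of $\mathrm{M}$ and $f(S)$ contains a basis of $\mathrm{N}$. The set of bases of $f$ is denoted $\mathscr{B}(f)$. *)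

theory Defs
  imports "HOL-Analysis.Analysis" "HOL-Analysis.Finite_Function_Topology"
begin

locale matroid =
  fixes E :: "'a set" and rk :: "'a set \<Rightarrow> nat"
  assumes finite_ground: "finite E"
    and rk_le_card: "S \<subseteq> E \<Longrightarrow> rk S \<le> card S"
    and rk_mono: "S \<subseteq> T \<Longrightarrow> T \<subseteq> E \<Longrightarrow> rk S \<le> rk T"
    and rk_submodular:
      "S \<subseteq> E \<Longrightarrow> T \<subseteq> E \<Longrightarrow> rk (S \<union> T) + rk (S \<inter> T) \<le> rk S + rk T"

definition matroid_basis :: "'a set \<Rightarrow> ('a set \<Rightarrow> nat) \<Rightarrow> 'a set \<Rightarrow> bool" where
  "matroid_basis E rk S \<longleftrightarrow> S \<subseteq> E \<and> rk S = card S \<and> card S = rk E"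

(* The rank differences are taken in int, so that no truncated subtraction occurs. *)
definition matroid_morphism ::
  "'a set \<Rightarrow> ('a set \<Rightarrow> nat) \<Rightarrow> 'b set \<Rightarrow> ('b set \<Rightarrow> nat) \<Rightarrow> ('a \<Rightarrow> 'b) \<Rightarrow> bool" where
  "matroid_morphism E rkM F rkN f \<longleftrightarrow>
     f \<in> E \<rightarrow> F \<and>
     (\<forall>S1 S2. S1 \<subseteq> S2 \<and> S2 \<subseteq> E \<longrightarrow>
        int (rkN (f ` S2)) - int (rkN (f ` S1)) \<le> int (rkM S2) - int (rkM S1))"

definition morphism_bases ::
  "'a set \<Rightarrow> ('a set \<Rightarrow> nat) \<Rightarrow> 'b set \<Rightarrow> ('b set \<Rightarrow> nat) \<Rightarrow> ('a \<Rightarrow> 'b) \<Rightarrow> 'a set set" where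
  "morphism_bases E rkM F rkN f =
     {S. S \<subseteq> E \<and> (\<exists>A. matroid_basis E rkM A \<and> S \<subseteq> A) \<and>
         (\<exists>B. matroid_basis F rkN B \<and> B \<subseteq> f ` S)}"

(* The real vector space R^E, for an arbitrary (possibly empty) finite set E, is the subspace of
   the finitely supported functions 'a => real consisting of those supported in E; this type
   is an instance of real_vector, so that the library's concave_on applies to it. *)
definition coord_space :: "'a set \<Rightarrow> ('a \<Rightarrow>\<^sub>0 real) set" where
  "coord_space E = {w. Poly_Mapping.keys w \<subseteq> E}"

definition positive_orthant :: "'a set \<Rightarrow> ('a \<Rightarrow>\<^sub>0 real) set" where
  "positive_orthant E = {w \<in> coord_space E. \<forall>i\<in>E. 0 < Poly_Mapping.lookup w i}"

definition basis_gen_poly ::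
  "'a set \<Rightarrow> ('a set \<Rightarrow> nat) \<Rightarrow> 'b set \<Rightarrow> ('b set \<Rightarrow> nat) \<Rightarrow> ('a \<Rightarrow> 'b) \<Rightarrow> ('a \<Rightarrow>\<^sub>0 real) \<Rightarrow> real" where
  "basis_gen_poly E rkM F rkN f w =
     (\<Sum>S\<in>morphism_bases E rkM F rkN f. \<Prod>i\<in>S. Poly_Mapping.lookup w i)"

end

theory Submission
  imports Defs
begin

text \<open>
  Pulling \<open>N\<close> back along \<open>f\<close> gives a second matroid on \<open>E\<close>, with rank function
  \<open>\<rho> S = rkN (f ` S)\<close>, which is a quotient of \<open>M\<close>; if \<open>f\<close> has a basis at all, its bases are the sets
  that are independent in \<open>M\<close> and spanning in this quotient. Let \<open>h\<close> be their generating polynomial,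
  \<open>n = card E\<close>, which may be assumed to be at least two, and \<open>p\<close> the homogenisation of \<open>h\<close> to degree \<open>n\<close> by one more variable \<open>w\<^sub>0\<close>, so that
  a basis \<open>S\<close> contributes \<open>w\<^sub>0\<close> to the power \<open>n - card S\<close>. The theorem is a consequence of the
  reverse Cauchy-Schwarz inequality
  \<open>Q(x,x) Q(u,u) \<le> Q(u,x)\<^sup>2\<close> for the Hessian \<open>Q\<close> of \<open>p\<close> at \<open>u = (1,w)\<close>. Indeed, by Euler's identity
  \<open>Q(u,u) = n (n-1) p\<close> and \<open>Q(u,x)\<close> is \<open>n-1\<close> times the derivative of \<open>p\<close> in direction \<open>x\<close>; for
  \<open>x\<close> with \<open>x\<^sub>0 = 0\<close> this says that \<open>h\<close> times its second derivative along \<open>x\<close> is at most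
  \<open>1 - 1/n\<close> times the square of its first derivative, so that the second derivative of \<open>ln h\<close> along
  \<open>x\<close> is nonpositive. Homogenising to degree \<open>n\<close>, and not merely to the rank of \<open>M\<close>, matters: with the
  smaller degree the inequality fails already for the uniform matroids of rank two on more
  than two elements, with a quotient of rank zero.

  The inequality is proved for all partial derivatives of \<open>p\<close> of degree at least two, by induction
  on the degree. Only the point \<open>u\<close> is ever considered; the coordinates are rescaled so that \<open>u\<close>
  becomes the all-one vector, and then the derivatives are merely numbers \<open>Y \<alpha>\<close>, indexed by multisets \<open>\<alpha>\<close>
  of variables and related by Euler's identity
  (\<open>reverse_cauchy_schwarz_local_to_global\<close>). Three facts carry the proof.

  Trickling down (\<open>trickle_down_nonpos\<close>). Let \<open>A\<close> be the Hessian of a derivative of degree \<open>d > 2\<close>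
  and \<open>m\<close> its row sums. Summing the inequalities for the Hessians of its partial derivatives gives
  \<open>x\<^sup>T A x \<le> \<Sum>i. (A x)\<^sub>i\<^sup>2 / m\<^sub>i\<close>, which says that each eigenvalue \<open>\<lambda>\<close> of the random
  walk \<open>A / m\<close> satisfies \<open>\<lambda> \<le> \<lambda>\<^sup>2\<close>. If the walk is connected, the eigenvalue \<open>1\<close> is simple and all
  others are smaller than \<open>1\<close>, hence nonpositive.

  Connectivity (\<open>partial_connected\<close>). After contracting the elements of \<open>\<alpha>\<close>, two variables are
  joined by an edge if they occur together in a basis of bounded size, where \<open>w\<^sub>0\<close> occurs with a basis
  if that basis is smaller than the bound. Basis exchange, in \<open>M\<close> or in the quotient, provides the paths.

  Degree two (\<open>rank_two_link_le_square\<close>). Here only bases with at most two elements remain, and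
  the form is described by the parallel classes of \<open>M\<close> or of the quotient. It is a square of a linear
  form minus a positive semidefinite form; when the empty set is a basis, this uses that there are
  at most as many parallel classes as elements, and that is where the degree \<open>n\<close> enters.
\<close>

section \<open>Reverse Cauchy-Schwarz inequality for symmetric forms\<close>

definition bilin :: "'i set \<Rightarrow> ('i \<Rightarrow> 'i \<Rightarrow> real) \<Rightarrow> ('i \<Rightarrow> real) \<Rightarrow> ('i \<Rightarrow> real) \<Rightarrow> real" where
  "bilin V A x y = (\<Sum>i\<in>V. \<Sum>j\<in>V. A i j * x i * y j)"

lemma bilin_add_scale:
  assumes "\<And>i j. i \<in> V \<Longrightarrow> j \<in> V \<Longrightarrow> A i j = A j i"
  shows "bilin V A (\<lambda>i. x i + t * y i) (\<lambda>i. x i + t * y i)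
           = bilin V A x x + 2 * t * bilin V A x y + t\<^sup>2 * bilin V A y y"
proof -
  have sym: "bilin V A y x = bilin V A x y"
    unfolding bilin_def by (subst sum.swap) (auto intro!: sum.cong simp: assms algebra_simps)
  have "bilin V A (\<lambda>i. x i + t * y i) (\<lambda>i. x i + t * y i)
      = bilin V A x x + t * bilin V A x y + t * bilin V A y x + t\<^sup>2 * bilin V A y y"
    unfolding bilin_def sum_distrib_left sum.distrib[symmetric]
    by (intro sum.cong) (auto simp: algebra_simps power2_eq_square)
  then show ?thesis by (simp add: sym)
qed

text \<open>
  The inequality \<open>Q(x,x) Q(u,u) \<le> Q(u,x)\<^sup>2\<close> for the form \<open>Q\<close> of the matrix \<open>A\<close>, at the all-one vector \<open>u\<close>.
  For a nonzero symmetric matrix with nonnegative entries it says that \<open>A\<close> has exactly one positive eigenvalue.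
\<close>

definition reverse_cauchy_schwarz :: "'i set \<Rightarrow> ('i \<Rightarrow> 'i \<Rightarrow> real) \<Rightarrow> bool" where
  "reverse_cauchy_schwarz V A \<longleftrightarrow>
     (\<forall>x. bilin V A x x * (\<Sum>i\<in>V. \<Sum>j\<in>V. A i j) \<le> (\<Sum>i\<in>V. \<Sum>j\<in>V. A i j * x j)\<^sup>2)"

lemma bilin_one: "bilin V A (\<lambda>_. 1) x = (\<Sum>i\<in>V. \<Sum>j\<in>V. A i j * x j)"
  by (simp add: bilin_def)

lemma reverse_cauchy_schwarzD:
  "reverse_cauchy_schwarz V A \<Longrightarrow>
     bilin V A x x * (\<Sum>i\<in>V. \<Sum>j\<in>V. A i j) \<le> (\<Sum>i\<in>V. \<Sum>j\<in>V. A i j * x j)\<^sup>2"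
  unfolding reverse_cauchy_schwarz_def by blast

text \<open>
  Every \<open>x\<close> is the sum of a multiple of the all-one vector and of a vector that is \<open>Q\<close>-orthogonal to it;
  comparing \<open>Q(x,x)\<close> with the contribution of the first summand gives the inequality.
\<close>

lemma reverse_cauchy_schwarzI:
  assumes sym: "\<And>i j. i \<in> V \<Longrightarrow> j \<in> V \<Longrightarrow> A i j = A j i"
    and nonneg: "\<And>i j. i \<in> V \<Longrightarrow> j \<in> V \<Longrightarrow> 0 \<le> A i j"
    and orth: "\<And>x. (\<Sum>i\<in>V. \<Sum>j\<in>V. A i j * x j) = 0 \<Longrightarrow> bilin V A x x \<le> 0"
  shows "reverse_cauchy_schwarz V A"
  unfolding reverse_cauchy_schwarz_def
proof
  fix x
  define b where "b = bilin V A (\<lambda>_. 1) x"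
  define c where "c = (\<Sum>i\<in>V. \<Sum>j\<in>V. A i j)"
  have c1: "bilin V A (\<lambda>_. 1) (\<lambda>_. 1) = c" by (simp add: bilin_def c_def)
  have c0: "0 \<le> c" unfolding c_def by (intro sum_nonneg nonneg)
  show "bilin V A x x * c \<le> (\<Sum>i\<in>V. \<Sum>j\<in>V. A i j * x j)\<^sup>2"
  proof (cases "c = 0")
    case False
    define t where "t = - (b / c)"
    have "bilin V A (\<lambda>_. 1) (\<lambda>i. x i + t * 1) = b + t * c"
      unfolding b_def c1[symmetric] unfolding bilin_def sum_distrib_left sum.distrib[symmetric]
      by (intro sum.cong) (auto simp: algebra_simps)
    also have "\<dots> = 0" using False by (simp add: t_def)
    finally have "bilin V A (\<lambda>i. x i + t * 1) (\<lambda>i. x i + t * 1) \<le> 0"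
      by (intro orth) (simp add: bilin_one)
    moreover have "bilin V A x (\<lambda>_. 1) = b"
      unfolding b_def bilin_def by (subst sum.swap) (auto simp: sym intro!: sum.cong)
    ultimately have "bilin V A x x + 2 * t * b + t\<^sup>2 * c \<le> 0"
      using bilin_add_scale[of V A x t "\<lambda>_. 1", OF sym] c1 by simp
    then have "bilin V A x x - b\<^sup>2 / c \<le> 0"
      using False by (simp add: t_def power2_eq_square field_simps)
    then have "bilin V A x x * c \<le> b\<^sup>2"
      using False c0 by (simp add: field_simps)
    then show ?thesis by (simp add: b_def bilin_one)
  qed simp
qed

text \<open>
  The form is at most the square of a linear form \<open>l\<close>, so it is nonpositive on the kernel of \<open>l\<close>. If \<open>x\<close> is
  \<open>Q\<close>-orthogonal to the all-one vector, then moving \<open>x\<close> along that vector into the kernel of \<open>l\<close> can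
  only increase \<open>Q(x,x)\<close>. This is impossible if \<open>l\<close> vanishes at the all-one vector; but then the sum of all
  entries of the matrix is at most zero, and the matrix is zero.
\<close>

lemma reverse_cauchy_schwarz_if_le_square:
  assumes fin: "finite V"
    and sym: "\<And>i j. i \<in> V \<Longrightarrow> j \<in> V \<Longrightarrow> A i j = A j i"
    and nonneg: "\<And>i j. i \<in> V \<Longrightarrow> j \<in> V \<Longrightarrow> 0 \<le> A i j"
    and le: "\<And>x. bilin V A x x \<le> (\<Sum>i\<in>V. c i * x i)\<^sup>2"
  shows "reverse_cauchy_schwarz V A"
proof (rule reverse_cauchy_schwarzI[OF sym nonneg])
  fix x assume orth: "(\<Sum>i\<in>V. \<Sum>j\<in>V. A i j * x j) = 0"
  define l where "l y = (\<Sum>i\<in>V. c i * y i)" for y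
  have one_nonneg: "0 \<le> bilin V A (\<lambda>_. 1) (\<lambda>_. 1)"
    unfolding bilin_def using nonneg by (intro sum_nonneg) auto
  show "bilin V A x x \<le> 0"
  proof (cases "l (\<lambda>_. 1) = 0")
    case True
    then have "(\<Sum>i\<in>V. \<Sum>j\<in>V. A i j) = 0"
      using le[of "\<lambda>_. 1"] one_nonneg by (simp add: l_def bilin_def)
    then have "\<forall>i\<in>V. \<forall>j\<in>V. A i j = 0"
      using fin nonneg by (simp add: sum_nonneg_eq_0_iff sum_nonneg)
    then show ?thesis by (simp add: bilin_def)
  next
    case False
    define t where "t = - l x / l (\<lambda>_. 1)"
    have "l (\<lambda>i. x i + t * 1) = l x + t * l (\<lambda>_. 1)"
      unfolding l_def sum_distrib_left sum.distrib[symmetric]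
      by (intro sum.cong) (auto simp: algebra_simps)
    also have "\<dots> = 0" using False by (simp add: t_def)
    finally have "bilin V A (\<lambda>i. x i + t * 1) (\<lambda>i. x i + t * 1) \<le> 0"
      using le[of "\<lambda>i. x i + t * 1"] by (simp add: l_def)
    moreover have "bilin V A x (\<lambda>_. 1) = 0"
      using orth unfolding bilin_def by (subst sum.swap) (simp add: sym cong: sum.cong)
    ultimately have "bilin V A x x + t\<^sup>2 * bilin V A (\<lambda>_. 1) (\<lambda>_. 1) \<le> 0"
      using bilin_add_scale[of V A x t "\<lambda>_. 1", OF sym] by simp
    moreover have "0 \<le> t\<^sup>2 * bilin V A (\<lambda>_. 1) (\<lambda>_. 1)" using one_nonneg by simp
    ultimately show ?thesis by linarith
  qed
qed

section \<open>The trickle-down theorem\<close>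

text \<open>
  Extending by zero outside \<open>V\<close> makes this a closed subset of a product of compact intervals, so that it is compact in
  the product topology, for any index type.
\<close>

lemma compact_weighted_sphere_on_finite:
  fixes V :: "'i set" and m :: "'i \<Rightarrow> real"
  assumes "finite V" and mpos: "\<And>i. i \<in> V \<Longrightarrow> 0 < m i"
  shows "compact {x. (\<forall>i. i \<notin> V \<longrightarrow> x i = 0) \<and> (\<Sum>i\<in>V. m i * (x i)\<^sup>2) = 1 \<and> (\<Sum>i\<in>V. m i * x i) = 0}"
    (is "compact ?K")
proof -
  define b where "b i = (if i \<in> V then {- (1 + 1 / m i) .. 1 + 1 / m i} else {0})" for i
  have "compactin (product_topology (\<lambda>_. euclideanreal) UNIV) (PiE UNIV b)"
    by (subst compactin_PiE) (auto simp: b_def)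
  then have cb: "compact (PiE UNIV b)"
    by (simp add: euclidean_product_topology)
  have coord: "continuous_on UNIV (\<lambda>x::'i \<Rightarrow> real. x i)" for i
    by simp
  have "closed {x::'i \<Rightarrow> real. (\<Sum>i\<in>V. m i * (x i)\<^sup>2) = 1}"
    by (intro closed_Collect_eq continuous_intros coord)
  moreover have "closed {x::'i \<Rightarrow> real. (\<Sum>i\<in>V. m i * x i) = 0}"
    by (intro closed_Collect_eq continuous_intros coord)
  ultimately have cl: "closed ({x. (\<Sum>i\<in>V. m i * (x i)\<^sup>2) = 1} \<inter> {x::'i \<Rightarrow> real. (\<Sum>i\<in>V. m i * x i) = 0})"
    by blast
  have bound: "\<bar>x i\<bar> \<le> 1 + 1 / m i" if "i \<in> V" "(\<Sum>i\<in>V. m i * (x i)\<^sup>2) = 1" for x :: "'i \<Rightarrow> real" and i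
  proof -
    have "m i * (x i)\<^sup>2 \<le> (\<Sum>i\<in>V. m i * (x i)\<^sup>2)"
      using assms that by (intro member_le_sum) (auto simp: less_imp_le)
    then have "(x i)\<^sup>2 \<le> 1 / m i"
      using that mpos[OF that(1)] by (simp add: field_simps)
    also have "\<dots> \<le> (1 + 1 / m i)\<^sup>2"
      using mpos[OF that(1)] by (simp add: power2_eq_square field_simps)
    finally show ?thesis
      using mpos[OF that(1)] by (intro power2_le_imp_le[of "\<bar>x i\<bar>"]) (auto simp: field_simps)
  qed
  have "?K = PiE UNIV b \<inter> ({x. (\<Sum>i\<in>V. m i * (x i)\<^sup>2) = 1} \<inter> {x. (\<Sum>i\<in>V. m i * x i) = 0})"
  proof (intro equalityI subsetI)
    fix x assume x: "x \<in> ?K"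
    have "x i \<in> b i" for i
      using bound[of i x] x by (cases "i \<in> V") (auto simp: b_def abs_le_iff)
    then show "x \<in> PiE UNIV b \<inter> ({x. (\<Sum>i\<in>V. m i * (x i)\<^sup>2) = 1} \<inter> {x. (\<Sum>i\<in>V. m i * x i) = 0})"
      using x by auto
  next
    fix x assume x: "x \<in> PiE UNIV b \<inter> ({x. (\<Sum>i\<in>V. m i * (x i)\<^sup>2) = 1} \<inter> {x. (\<Sum>i\<in>V. m i * x i) = 0})"
    then have "x i = 0" if "i \<notin> V" for i
      using that by (auto simp: b_def PiE_def Pi_def split: if_splits)
    then show "x \<in> ?K" using x by auto
  qed
  then show ?thesis
    using compact_Int_closed[OF cb cl] by simp
qed

lemma eq_0_if_linear_le_quadratic:
  fixes a b :: real
  assumes "\<And>t. t * a \<le> t\<^sup>2 * b" "0 \<le> a"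
  shows "a = 0"
proof (rule ccontr)
  assume "a \<noteq> 0"
  then have a: "0 < a" using assms(2) by simp
  define t where "t = a / (2 * (\<bar>b\<bar> + 1))"
  have t: "0 < t" using a by (simp add: t_def)
  have "t * a \<le> t * (t * b)" using assms(1)[of t] by (simp add: power2_eq_square algebra_simps)
  then have "a \<le> t * b" using t by simp
  also have "\<dots> \<le> t * (\<bar>b\<bar> + 1)" using t by (intro mult_left_mono) auto
  also have "\<dots> = a / 2" unfolding t_def by (simp add: field_simps)
  finally show False using a by simp
qed

text \<open>
  The orthogonal complement of the constants, with respect to the weights \<open>m\<close>, is invariant under the
  random walk \<open>A / m\<close>, which is self-adjoint for these weights. If the form were positive
  somewhere on it, a maximiser of the Rayleigh quotient would be an eigenvector with eigenvalue
  \<open>l > 0\<close>. The hypothesis on the squares turns into \<open>l \<le> l\<^sup>2\<close>, so \<open>l \<ge> 1\<close>; but then the Dirichlet form of the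
  eigenvector vanishes, and connectivity makes it constant, hence zero. Connectivity is
  expressed by saying that functions which agree along all edges are constant.
\<close>

lemma trickle_down_nonpos:
  fixes V :: "'i set" and A :: "'i \<Rightarrow> 'i \<Rightarrow> real"
  defines "m \<equiv> \<lambda>i. \<Sum>j\<in>V. A i j"
  assumes fin: "finite V"
    and sym: "\<And>i j. i \<in> V \<Longrightarrow> j \<in> V \<Longrightarrow> A i j = A j i"
    and nonneg: "\<And>i j. i \<in> V \<Longrightarrow> j \<in> V \<Longrightarrow> 0 \<le> A i j"
    and mpos: "\<And>i. i \<in> V \<Longrightarrow> 0 < m i"
    and conn: "\<And>y :: 'i \<Rightarrow> real. (\<And>i j. i \<in> V \<Longrightarrow> j \<in> V \<Longrightarrow> 0 < A i j \<Longrightarrow> y i = y j)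
                 \<Longrightarrow> (\<And>i j. i \<in> V \<Longrightarrow> j \<in> V \<Longrightarrow> y i = y j)"
    and link: "\<And>x. bilin V A x x \<le> (\<Sum>i\<in>V. (\<Sum>j\<in>V. A i j * x j)\<^sup>2 / m i)"
    and orth: "(\<Sum>i\<in>V. m i * x i) = 0"
  shows "bilin V A x x \<le> 0"
proof (rule ccontr)
  assume neg: "\<not> bilin V A x x \<le> 0"
  define N where "N y = (\<Sum>i\<in>V. m i * (y i)\<^sup>2)" for y :: "'i \<Rightarrow> real"
  define K where "K = {x. (\<forall>i. i \<notin> V \<longrightarrow> x i = 0) \<and> (\<Sum>i\<in>V. m i * (x i)\<^sup>2) = 1 \<and> (\<Sum>i\<in>V. m i * x i) = 0}"
  have bil_cong: "bilin V A y y = bilin V A z z" if "\<And>i. i \<in> V \<Longrightarrow> y i = z i" for y z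
    unfolding bilin_def using that by (intro sum.cong) auto
  have N0: "N y = 0 \<longleftrightarrow> (\<forall>i\<in>V. y i = 0)" for y
    unfolding N_def using fin mpos
    by (subst sum_nonneg_eq_0_iff) (auto simp: less_imp_le, force)
  have N_nonneg: "0 \<le> N y" for y
    unfolding N_def using mpos by (intro sum_nonneg) (auto simp: less_imp_le)
  have normalise: "(\<lambda>i. if i \<in> V then y i / sqrt (N y) else 0) \<in> K"
      "bilin V A y y = N y * bilin V A (\<lambda>i. if i \<in> V then y i / sqrt (N y) else 0) (\<lambda>i. if i \<in> V then y i / sqrt (N y) else 0)"
    if "N y \<noteq> 0" "(\<Sum>i\<in>V. m i * y i) = 0" for y
  proof -
    have s: "(sqrt (N y))\<^sup>2 = N y" "sqrt (N y) \<noteq> 0" "N y > 0"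
      using N_nonneg[of y] that(1) by auto
    have "(\<Sum>i\<in>V. m i * (if i \<in> V then y i / sqrt (N y) else 0)\<^sup>2) = (\<Sum>i\<in>V. m i * (y i)\<^sup>2) / N y"
      unfolding sum_divide_distrib using s(1) by (intro sum.cong) (auto simp: power_divide)
    moreover have "(\<Sum>i\<in>V. m i * (if i \<in> V then y i / sqrt (N y) else 0)) = (\<Sum>i\<in>V. m i * y i) / sqrt (N y)"
      unfolding sum_divide_distrib by (intro sum.cong) auto
    moreover have "(\<Sum>i\<in>V. m i * (y i)\<^sup>2) / N y = 1"
      unfolding N_def[symmetric] using that(1) by simp
    ultimately show "(\<lambda>i. if i \<in> V then y i / sqrt (N y) else 0) \<in> K"
      using that(2) unfolding K_def by simp
    show "bilin V A y y = N y * bilin V A (\<lambda>i. if i \<in> V then y i / sqrt (N y) else 0) (\<lambda>i. if i \<in> V then y i / sqrt (N y) else 0)"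
      unfolding bilin_def sum_distrib_left using s by (intro sum.cong) auto
  qed
  have "N x \<noteq> 0"
  proof
    assume "N x = 0"
    then have "bilin V A x x = 0" unfolding N0 bilin_def by auto
    then show False using neg by simp
  qed
  then have "K \<noteq> {}" using normalise(1) orth by blast
  moreover have "compact K"
    unfolding K_def using fin mpos by (rule compact_weighted_sphere_on_finite)
  moreover have "continuous_on K (\<lambda>z. bilin V A z z)"
    unfolding bilin_def by (intro continuous_intros continuous_on_subset[OF continuous_on_product_coordinates]) auto
  ultimately obtain z where z: "z \<in> K" and zmax: "\<And>y. y \<in> K \<Longrightarrow> bilin V A y y \<le> bilin V A z z"
    using continuous_attains_sup[of K "\<lambda>z. bilin V A z z"] by auto
  define l where "l = bilin V A z z"
  have Nz: "N z = 1" and oz: "(\<Sum>i\<in>V. m i * z i) = 0"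
    using z by (auto simp: K_def N_def)
  have max: "bilin V A y y \<le> l * N y" if "(\<Sum>i\<in>V. m i * y i) = 0" for y
  proof (cases "N y = 0")
    case True
    then have "bilin V A y y = 0" unfolding N0 bilin_def by auto
    then show ?thesis using True by simp
  next
    case False
    show ?thesis
      unfolding normalise(2)[OF False that] l_def mult.commute[of "bilin V A z z"]
      by (rule mult_left_mono[OF zmax[OF normalise(1)[OF False that]] N_nonneg])
  qed
  have "0 < l * N x" using max[OF orth] neg by linarith
  then have lpos: "0 < l" using N_nonneg[of x] by (simp add: zero_less_mult_iff)
  \<comment> \<open>The defect of the eigenvalue equation; it is itself a direction orthogonal to the constants.\<close>
  define h where "h i = (\<Sum>j\<in>V. A i j * z j) / m i - l * z i" for i
  have mh: "m i * h i = (\<Sum>j\<in>V. A i j * z j) - l * (m i * z i)" if "i \<in> V" for i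
    using mpos[OF that] by (simp add: h_def algebra_simps)
  have oh: "(\<Sum>i\<in>V. m i * h i) = 0"
  proof -
    have "(\<Sum>i\<in>V. m i * h i) = (\<Sum>i\<in>V. \<Sum>j\<in>V. A i j * z j) - l * (\<Sum>i\<in>V. m i * z i)"
      by (simp add: mh sum_subtractf sum_distrib_left)
    also have "(\<Sum>i\<in>V. \<Sum>j\<in>V. A i j * z j) = (\<Sum>j\<in>V. m j * z j)"
      unfolding m_def by (subst sum.swap) (auto simp: sum_distrib_right sym intro!: sum.cong)
    finally show ?thesis using oz by simp
  qed
  have hz: "bilin V A z h = N h + l * (\<Sum>i\<in>V. m i * z i * h i)"
  proof -
    have "bilin V A z h = (\<Sum>j\<in>V. (\<Sum>i\<in>V. A j i * z i) * h j)"
      unfolding bilin_def by (subst sum.swap) (auto simp: sum_distrib_right sym intro!: sum.cong)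
    also have "\<dots> = (\<Sum>j\<in>V. (m j * h j + l * (m j * z j)) * h j)"
      by (intro sum.cong) (auto simp: mh)
    finally show ?thesis
      by (simp add: N_def sum_distrib_left sum.distrib algebra_simps power2_eq_square)
  qed
  have "t * (2 * N h) \<le> t\<^sup>2 * (l * N h - bilin V A h h)" for t
  proof -
    have "(\<Sum>i\<in>V. m i * (z i + t * h i)) = 0"
    proof -
      have "(\<Sum>i\<in>V. m i * (z i + t * h i)) = (\<Sum>i\<in>V. m i * z i) + t * (\<Sum>i\<in>V. m i * h i)"
        unfolding sum_distrib_left sum.distrib[symmetric] by (intro sum.cong) (auto simp: algebra_simps)
      then show ?thesis using oz oh by simp
    qed
    note max[OF this]
    moreover have "N (\<lambda>i. z i + t * h i) = N z + 2 * t * (\<Sum>i\<in>V. m i * z i * h i) + t\<^sup>2 * N h"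
      unfolding N_def sum_distrib_left sum.distrib[symmetric]
      by (intro sum.cong) (auto simp: algebra_simps power2_eq_square)
    ultimately show ?thesis
      using bilin_add_scale[of V A z t h, OF sym] Nz hz l_def by (simp add: algebra_simps)
  qed
  \<comment> \<open>First-order optimality: moving the maximiser by \<open>t h\<close> changes the form minus \<open>l N\<close> by \<open>2 t N h\<close> to first order.\<close>
  from eq_0_if_linear_le_quadratic[OF this] have "N h = 0" using N_nonneg[of h] by simp
  then have eig: "(\<Sum>j\<in>V. A i j * z j) = l * (m i * z i)" if "i \<in> V" for i
    using mh[OF that] that by (simp add: N0)
  have "l \<le> (\<Sum>i\<in>V. (\<Sum>j\<in>V. A i j * z j)\<^sup>2 / m i)"
    using link[of z] by (simp add: l_def)
  also have "\<dots> = (\<Sum>i\<in>V. l\<^sup>2 * (m i * (z i)\<^sup>2))"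
    by (intro sum.cong refl) (use mpos in \<open>force simp: eig power2_eq_square\<close>)
  also have "\<dots> = l\<^sup>2" using Nz by (simp add: sum_distrib_left[symmetric] N_def)
  finally have l1: "1 \<le> l" using lpos by (simp add: power2_eq_square)
  \<comment> \<open>The Dirichlet form of the walk at the eigenvector.\<close>
  have "(\<Sum>i\<in>V. \<Sum>j\<in>V. A i j * (z i - z j)\<^sup>2) = 2 * N z - 2 * l"
  proof -
    have "(\<Sum>i\<in>V. \<Sum>j\<in>V. A i j * (z i - z j)\<^sup>2)
        = (\<Sum>i\<in>V. \<Sum>j\<in>V. A i j * (z i)\<^sup>2) + (\<Sum>i\<in>V. \<Sum>j\<in>V. A i j * (z j)\<^sup>2) - 2 * bilin V A z z"
      unfolding bilin_def sum_distrib_left sum.distrib[symmetric] sum_subtractf[symmetric]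
      by (intro sum.cong) (auto simp: algebra_simps power2_eq_square)
    also have "(\<Sum>i\<in>V. \<Sum>j\<in>V. A i j * (z j)\<^sup>2) = (\<Sum>i\<in>V. \<Sum>j\<in>V. A i j * (z i)\<^sup>2)"
      by (subst sum.swap) (auto simp: sym intro!: sum.cong)
    also have "(\<Sum>i\<in>V. \<Sum>j\<in>V. A i j * (z i)\<^sup>2) = N z"
      unfolding N_def m_def by (simp add: sum_distrib_right)
    finally show ?thesis by (simp add: l_def)
  qed
  then have le0: "(\<Sum>i\<in>V. \<Sum>j\<in>V. A i j * (z i - z j)\<^sup>2) \<le> 0" using l1 Nz by simp
  have "A i j * (z i - z j)\<^sup>2 = 0" if "i \<in> V" "j \<in> V" for i j
  proof -
    have "A i j * (z i - z j)\<^sup>2 \<le> (\<Sum>j\<in>V. A i j * (z i - z j)\<^sup>2)"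
      using that fin nonneg by (intro member_le_sum) auto
    also have "\<dots> \<le> (\<Sum>i\<in>V. \<Sum>j\<in>V. A i j * (z i - z j)\<^sup>2)"
      using that fin nonneg by (intro member_le_sum[of i V "\<lambda>i. \<Sum>j\<in>V. A i j * (z i - z j)\<^sup>2"] sum_nonneg) auto
    finally show ?thesis using le0 nonneg[OF that] by (intro antisym) auto
  qed
  then have "z i = z j" if "i \<in> V" "j \<in> V" "0 < A i j" for i j
    using that by force
  then have const: "z i = z j" if "i \<in> V" "j \<in> V" for i j
    using conn[of z] that by blast
  have "V \<noteq> {}" using Nz by (auto simp: N_def)
  then obtain i0 where i0: "i0 \<in> V" by blast
  have "(\<Sum>i\<in>V. m i * z i) = z i0 * (\<Sum>i\<in>V. m i)"
    unfolding sum_distrib_left using const i0 by (intro sum.cong refl) (metis mult.commute)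
  moreover have "0 < (\<Sum>i\<in>V. m i)"
    using fin mpos i0 by (intro sum_pos) auto
  ultimately have "z i0 = 0" using oz by simp
  then have "N z = 0" using const i0 by (metis N0)
  then show False using Nz by simp
qed



text \<open>
  Let \<open>Y \<alpha>\<close> be the value at the all-one vector of the derivative of order \<open>\<alpha>\<close> of a homogeneous
  polynomial of degree \<open>n\<close>. Then the Hessian of the derivative of order \<open>\<alpha>\<close> is, up to a positive
  factor, the sum of the Hessians of its partial derivatives, and its row sums are given by Euler's
  identity; so the inequalities for the partial derivatives add up to the hypothesis of
  the trickle-down lemma. Variables whose partial derivative vanishes have zero rows and are left out.
\<close>

theorem reverse_cauchy_schwarz_local_to_global:
  fixes I :: "'i set" and Y :: "'i multiset \<Rightarrow> real" and n :: nat
  assumes fin: "finite I"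
    and nonneg: "\<And>\<alpha>. set_mset \<alpha> \<subseteq> I \<Longrightarrow> 0 \<le> Y \<alpha>"
    and euler: "\<And>\<alpha>. set_mset \<alpha> \<subseteq> I \<Longrightarrow> size \<alpha> \<le> n \<Longrightarrow>
                  (\<Sum>i\<in>I. Y (add_mset i \<alpha>)) = real (n - size \<alpha>) * Y \<alpha>"
    and conn: "\<And>\<alpha> y i j. set_mset \<alpha> \<subseteq> I \<Longrightarrow> size \<alpha> + 2 \<le> n \<Longrightarrow>
                 (\<And>i j. i \<in> I \<Longrightarrow> j \<in> I \<Longrightarrow> 0 < Y (add_mset i (add_mset j \<alpha>)) \<Longrightarrow> y i = (y j :: real)) \<Longrightarrow>
                 i \<in> I \<Longrightarrow> j \<in> I \<Longrightarrow> 0 < Y (add_mset i \<alpha>) \<Longrightarrow> 0 < Y (add_mset j \<alpha>) \<Longrightarrow> y i = y j"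
    and base: "\<And>\<alpha>. set_mset \<alpha> \<subseteq> I \<Longrightarrow> size \<alpha> + 2 = n \<Longrightarrow>
                 reverse_cauchy_schwarz I (\<lambda>i j. Y (add_mset i (add_mset j \<alpha>)))"
    and "set_mset \<alpha> \<subseteq> I" "size \<alpha> + 2 \<le> n"
  shows "reverse_cauchy_schwarz I (\<lambda>i j. Y (add_mset i (add_mset j \<alpha>)))"
  using assms(6,7)
proof (induction "n - (size \<alpha> + 2)" arbitrary: \<alpha>)
  case 0
  then show ?case by (intro base) auto
next
  case (Suc k)
  define d where "d = n - size \<alpha>"
  have d: "d \<ge> 3" "d = k + 3" using Suc.hyps(2) Suc.prems by (auto simp: d_def)
  have n_eq: "n = size \<alpha> + (k + 3)" using Suc.hyps(2) Suc.prems by simp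
  define A where "A i j = Y (add_mset i (add_mset j \<alpha>))" for i j
  define V where "V = {i \<in> I. 0 < Y (add_mset i \<alpha>)}"
  have VI: "V \<subseteq> I" "finite V" using fin by (auto simp: V_def)
  have sym: "A i j = A j i" for i j by (simp add: A_def add_mset_commute)
  have Anonneg: "0 \<le> A i j" if "i \<in> I" "j \<in> I" for i j
    using that Suc.prems by (auto simp: A_def intro!: nonneg)
  have row: "(\<Sum>j\<in>I. A i j) = real (d - 1) * Y (add_mset i \<alpha>)" if "i \<in> I" for i
    using euler[of "add_mset i \<alpha>"] that Suc.prems
    by (simp add: A_def d(2) n_eq add_mset_commute[of i])
  have Aout: "A i j = 0" if "i \<in> I - V" "j \<in> I" for i j
  proof -
    have "Y (add_mset i \<alpha>) = 0"
      using that nonneg[of "add_mset i \<alpha>"] Suc.prems by (auto simp: V_def)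
    then have "(\<Sum>j\<in>I. A i j) = 0" using row that by simp
    then show ?thesis
      using that fin Anonneg by (subst (asm) sum_nonneg_eq_0_iff) auto
  qed
  have Aout': "A i j = 0" if "j \<in> I - V" "i \<in> I" for i j
    using Aout sym that by metis
  have restr1: "(\<Sum>j\<in>I. A i j * x j) = (\<Sum>j\<in>V. A i j * x j)" if "i \<in> I" for i x
    using that VI fin Aout' by (intro sum.mono_neutral_right) auto
  have restr2: "(\<Sum>i\<in>I. \<Sum>j\<in>I. A i j * x i * y j) = (\<Sum>i\<in>V. \<Sum>j\<in>V. A i j * x i * y j)" for x y
  proof -
    have "(\<Sum>i\<in>I. \<Sum>j\<in>I. A i j * x i * y j) = (\<Sum>i\<in>V. \<Sum>j\<in>I. A i j * x i * y j)"
      using VI fin Aout by (intro sum.mono_neutral_right) auto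
    also have "\<dots> = (\<Sum>i\<in>V. \<Sum>j\<in>V. A i j * x i * y j)"
      using VI fin Aout' by (intro sum.cong refl sum.mono_neutral_right) auto
    finally show ?thesis .
  qed
  have rowV: "(\<Sum>j\<in>V. A i j) = real (d - 1) * Y (add_mset i \<alpha>)" if "i \<in> V" for i
    using row[of i] restr1[of i "\<lambda>_. 1"] that VI by auto
  have mpos: "0 < (\<Sum>j\<in>V. A i j)" if "i \<in> V" for i
    using rowV that d by (auto simp: V_def)
  define q where "q u x = bilin I (\<lambda>i j. Y (add_mset i (add_mset j (add_mset u \<alpha>)))) x x" for u x
  have sub: "set_mset (add_mset u \<alpha>) \<subseteq> I" if "u \<in> I" for u using that Suc.prems by auto
  have q_le: "q u x \<le> real (d - 2) * (\<Sum>j\<in>I. A u j * x j)\<^sup>2 / (\<Sum>j\<in>V. A u j)" if "u \<in> V" for u x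
  proof -
    have uI: "u \<in> I" and Yu: "0 < Y (add_mset u \<alpha>)" using that by (auto simp: V_def)
    have rs: "(\<Sum>i\<in>I. Y (add_mset i (add_mset j (add_mset u \<alpha>)))) = real (d - 2) * A u j" if "j \<in> I" for j
      using euler[of "add_mset j (add_mset u \<alpha>)"] that uI Suc.prems
      by (simp add: A_def d(2) n_eq add_mset_commute)
    have rs': "(\<Sum>i\<in>I. \<Sum>j\<in>I. Y (add_mset i (add_mset j (add_mset u \<alpha>))) * x j)
        = real (d - 2) * (\<Sum>j\<in>I. A u j * x j)" for x
      by (subst sum.swap) (simp add: sum_distrib_right[symmetric] rs sum_distrib_left mult.assoc)
    have "reverse_cauchy_schwarz I (\<lambda>i j. Y (add_mset i (add_mset j (add_mset u \<alpha>))))"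
      using Suc.hyps(2) Suc.prems uI by (intro Suc.hyps(1)) auto
    from reverse_cauchy_schwarzD[OF this, of x]
    have "q u x * (real (d - 2) * (\<Sum>j\<in>I. A u j)) \<le> (real (d - 2) * (\<Sum>j\<in>I. A u j * x j))\<^sup>2"
      using rs'[of "\<lambda>_. 1"] rs'[of x] by (simp add: q_def)
    then have "real (d - 2) * (q u x * (\<Sum>j\<in>V. A u j)) \<le> real (d - 2) * (real (d - 2) * (\<Sum>j\<in>I. A u j * x j)\<^sup>2)"
      using restr1[OF uI, of "\<lambda>_. 1"] by (simp add: power2_eq_square algebra_simps)
    then have "q u x * (\<Sum>j\<in>V. A u j) \<le> real (d - 2) * (\<Sum>j\<in>I. A u j * x j)\<^sup>2"
      using d by simp
    then show ?thesis using mpos[OF that] by (simp add: pos_le_divide_eq)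
  qed
  have q_sum: "(\<Sum>u\<in>V. q u x) = real (d - 2) * bilin I A x x" for x
  proof -
    have q0: "q u x = 0" if "u \<in> I - V" for u
    proof -
      have "Y (add_mset i (add_mset j (add_mset u \<alpha>))) = 0" if "i \<in> I" "j \<in> I" for i j
      proof -
        have "(\<Sum>i\<in>I. Y (add_mset i (add_mset j (add_mset u \<alpha>)))) = 0"
          using euler[of "add_mset j (add_mset u \<alpha>)"] that \<open>u \<in> I - V\<close> Suc.prems
            Aout[of u j] by (simp add: A_def d(2) n_eq add_mset_commute)
        moreover have "0 \<le> Y (add_mset i (add_mset j (add_mset u \<alpha>)))" if "i \<in> I" for i
          using that \<open>j \<in> I\<close> \<open>u \<in> I - V\<close> Suc.prems by (intro nonneg) auto
        ultimately show ?thesis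
          using fin that by (subst (asm) sum_nonneg_eq_0_iff) auto
      qed
      then show ?thesis unfolding q_def bilin_def by (intro sum.neutral ballI) auto
    qed
    have "(\<Sum>u\<in>V. q u x) = (\<Sum>u\<in>I. q u x)"
      using VI fin q0 by (intro sum.mono_neutral_left) auto
    also have "\<dots> = (\<Sum>i\<in>I. \<Sum>j\<in>I. \<Sum>u\<in>I. Y (add_mset i (add_mset j (add_mset u \<alpha>))) * x i * x j)"
      unfolding q_def bilin_def by (rule trans[OF sum.swap], rule sum.cong[OF refl], rule sum.swap)
    also have "\<dots> = (\<Sum>i\<in>I. \<Sum>j\<in>I. real (d - 2) * (A i j * x i * x j))"
    proof (intro sum.cong refl)
      fix i j assume ij: "i \<in> I" "j \<in> I"
      have "(\<Sum>u\<in>I. Y (add_mset i (add_mset j (add_mset u \<alpha>)))) = real (d - 2) * A i j"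
        using euler[of "add_mset i (add_mset j \<alpha>)"] ij Suc.prems
        by (simp add: A_def d(2) n_eq add_mset_commute)
      then show "(\<Sum>u\<in>I. Y (add_mset i (add_mset j (add_mset u \<alpha>))) * x i * x j)
          = real (d - 2) * (A i j * x i * x j)"
        by (simp add: sum_distrib_right[symmetric])
    qed
    finally show ?thesis by (simp add: bilin_def sum_distrib_left)
  qed
  have orth: "bilin V A x x \<le> 0" if "(\<Sum>i\<in>V. (\<Sum>j\<in>V. A i j) * x i) = 0" for x
  proof (rule trickle_down_nonpos[OF VI(2) sym _ mpos _ _ that])
    show "0 \<le> A i j" if "i \<in> V" "j \<in> V" for i j using that VI Anonneg by blast
    show "y i = y j"
      if "\<And>i j. i \<in> V \<Longrightarrow> j \<in> V \<Longrightarrow> 0 < A i j \<Longrightarrow> y i = y j" "i \<in> V" "j \<in> V" for y :: "'i \<Rightarrow> real" and i j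
    proof (rule conn[of \<alpha>])
      show "y i = y j" if "i \<in> I" "j \<in> I" "0 < Y (add_mset i (add_mset j \<alpha>))" for i j
        using \<open>\<And>i j. i \<in> V \<Longrightarrow> j \<in> V \<Longrightarrow> 0 < A i j \<Longrightarrow> y i = y j\<close>[of i j] that Aout[of i j] Aout'[of j i]
        by (fastforce simp: A_def)
    qed (use that Suc.prems in \<open>auto simp: V_def\<close>)
    show "bilin V A x x \<le> (\<Sum>i\<in>V. (\<Sum>j\<in>V. A i j * x j)\<^sup>2 / (\<Sum>j\<in>V. A i j))" for x
    proof -
      have "real (d - 2) * bilin V A x x = (\<Sum>u\<in>V. q u x)"
        unfolding q_sum bilin_def restr2 ..
      also have "\<dots> \<le> (\<Sum>u\<in>V. real (d - 2) * (\<Sum>j\<in>I. A u j * x j)\<^sup>2 / (\<Sum>j\<in>V. A u j))"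
        by (intro sum_mono q_le)
      also have "\<dots> = real (d - 2) * (\<Sum>u\<in>V. (\<Sum>j\<in>V. A u j * x j)\<^sup>2 / (\<Sum>j\<in>V. A u j))"
        unfolding sum_distrib_left using restr1 VI by (intro sum.cong) auto
      finally show ?thesis using d by simp
    qed
  qed
  have "reverse_cauchy_schwarz I A"
  proof (rule reverse_cauchy_schwarzI)
    fix x assume "(\<Sum>i\<in>I. \<Sum>j\<in>I. A i j * x j) = 0"
    moreover have "(\<Sum>i\<in>I. \<Sum>j\<in>I. A i j * x j) = (\<Sum>i\<in>V. \<Sum>j\<in>V. A i j * x j)"
      using restr2[of "\<lambda>_. 1" x] by simp
    moreover have "(\<Sum>i\<in>V. \<Sum>j\<in>V. A i j * x j) = (\<Sum>i\<in>V. (\<Sum>j\<in>V. A i j) * x i)"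
      by (subst sum.swap) (auto simp: sum_distrib_right sym intro!: sum.cong)
    ultimately have "bilin V A x x \<le> 0" by (intro orth) simp
    then show "bilin I A x x \<le> 0" unfolding bilin_def restr2 .
  qed (use sym Anonneg in auto)
  then show ?case by (simp add: A_def[abs_def])
qed

section \<open>Independence, contraction and parallel elements in matroids\<close>

context matroid
begin

lemma rk_empty [simp]: "rk {} = 0"
  using rk_le_card[of "{}"] by simp

lemma finite_subset_ground: "S \<subseteq> E \<Longrightarrow> finite S"
  using finite_ground finite_subset by blast

lemma independent_subset:
  assumes "Z \<subseteq> E" "rk Z = card Z" "Y \<subseteq> Z"
  shows "rk Y = card Y"
proof -
  have "Y \<union> (Z - Y) = Z" "Y \<inter> (Z - Y) = {}" using assms by auto
  then have "rk Z \<le> rk Y + rk (Z - Y)"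
    using rk_submodular[of Y "Z - Y"] assms by auto
  moreover have "rk (Z - Y) \<le> card (Z - Y)" "rk Y \<le> card Y"
    using assms by (auto intro!: rk_le_card)
  moreover have "card Z = card Y + card (Z - Y)"
    using assms finite_subset_ground[of Z] by (metis card_Diff_subset card_mono finite_subset le_add_diff_inverse)
  ultimately show ?thesis using assms by linarith
qed

text \<open>
  Adding the elements of \<open>Z\<close> one at a time, submodularity keeps the rank equal to that of \<open>Y\<close>.
\<close>

lemma rk_eq_if_all_dependent:
  assumes "Y \<subseteq> Z" "Z \<subseteq> E" "\<And>e. e \<in> Z \<Longrightarrow> rk (insert e Y) = rk Y"
  shows "rk Z = rk Y"
proof -
  have "rk (Y \<union> W) = rk Y" if "finite W" "W \<subseteq> Z" for W
    using that
  proof (induction W rule: finite_induct)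
    case (insert e W)
    have "rk ((Y \<union> W) \<union> insert e Y) + rk ((Y \<union> W) \<inter> insert e Y) \<le> rk (Y \<union> W) + rk (insert e Y)"
      using insert.prems assms by (intro rk_submodular) auto
    moreover have "rk Y \<le> rk ((Y \<union> W) \<inter> insert e Y)"
      using insert.prems assms by (intro rk_mono) auto
    moreover have "rk Y \<le> rk (Y \<union> insert e W)"
      using insert.prems assms by (intro rk_mono) auto
    moreover have "(Y \<union> W) \<union> insert e Y = Y \<union> insert e W" by auto
    ultimately show ?case using insert assms(3)[of e] by auto
  qed simp
  from this[of Z] show ?thesis
    using assms finite_subset_ground by (simp add: Un_absorb1)
qed

text \<open>
  A largest independent set between \<open>X\<close> and \<open>Z\<close> spans \<open>Z\<close>. All the exchange arguments below are
  instances: if \<open>insert i S\<close> has the rank of the independent set \<open>S\<close>, then \<open>X = {i}\<close> and \<open>Z = insert i S\<close>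
  exchange some element of \<open>S\<close> for \<open>i\<close>.
\<close>

lemma independent_extend:
  assumes "X \<subseteq> Z" "Z \<subseteq> E" "rk X = card X"
  obtains Y where "X \<subseteq> Y" "Y \<subseteq> Z" "rk Y = card Y" "card Y = rk Z"
proof -
  define F where "F = {Y. X \<subseteq> Y \<and> Y \<subseteq> Z \<and> rk Y = card Y}"
  have fZ: "finite Z" using assms finite_subset_ground by blast
  have "finite F" using fZ by (auto simp: F_def intro: finite_subset[of _ "Pow Z"])
  moreover have "F \<noteq> {}" using assms by (auto simp: F_def)
  ultimately have "Max (card ` F) \<in> card ` F" by (intro Max_in) auto
  then obtain Y where Y: "Y \<in> F" "card Y = Max (card ` F)" by auto
  have Ymax: "card Y' \<le> card Y" if "Y' \<in> F" for Y'
    unfolding Y(2) using that \<open>finite F\<close> by (intro Max_ge) auto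
  have YZ: "X \<subseteq> Y" "Y \<subseteq> Z" "rk Y = card Y" using Y by (auto simp: F_def)
  have "rk (insert e Y) = rk Y" if "e \<in> Z" for e
  proof (cases "e \<in> Y")
    case False
    have fY: "finite Y" using YZ fZ finite_subset by blast
    have "rk Y \<le> rk (insert e Y)"
      by (rule rk_mono) (use that YZ assms in auto)
    moreover have "rk (insert e Y) \<le> card (insert e Y)"
      by (rule rk_le_card) (use that YZ assms in auto)
    moreover have "rk (insert e Y) \<noteq> card (insert e Y)"
    proof
      assume "rk (insert e Y) = card (insert e Y)"
      then have "insert e Y \<in> F" using that YZ by (auto simp: F_def)
      from Ymax[OF this] show False using False fY by simp
    qed
    ultimately show ?thesis using False fY YZ by simp
  qed (simp add: insert_absorb)
  then have "rk Z = rk Y" using rk_eq_if_all_dependent YZ assms by blast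
  with YZ show thesis by (intro that) auto
qed

lemma contract:
  assumes T: "T \<subseteq> E"
  shows "matroid (E - T) (\<lambda>S. rk (S \<union> T) - rk T)"
proof
  have le: "rk T \<le> rk (S \<union> T)" if "S \<subseteq> E - T" for S
    using that T by (intro rk_mono) auto
  show "finite (E - T)" using finite_ground by simp
  show "rk (S \<union> T) - rk T \<le> card S" if "S \<subseteq> E - T" for S
  proof -
    have "rk (S \<union> T) + rk (S \<inter> T) \<le> rk S + rk T" using that T by (intro rk_submodular) auto
    moreover have "rk S \<le> card S" using that by (intro rk_le_card) auto
    ultimately show ?thesis by simp
  qed
  show "rk (S \<union> T) - rk T \<le> rk (U \<union> T) - rk T" if "S \<subseteq> U" "U \<subseteq> E - T" for S U
  proof -
    have "rk (S \<union> T) \<le> rk (U \<union> T)" using that T by (intro rk_mono) auto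
    then show ?thesis by simp
  qed
  show "rk (S \<union> U \<union> T) - rk T + (rk (S \<inter> U \<union> T) - rk T) \<le> rk (S \<union> T) - rk T + (rk (U \<union> T) - rk T)"
    if "S \<subseteq> E - T" "U \<subseteq> E - T" for S U
  proof -
    have "rk ((S \<union> T) \<union> (U \<union> T)) + rk ((S \<union> T) \<inter> (U \<union> T)) \<le> rk (S \<union> T) + rk (U \<union> T)"
      using that T by (intro rk_submodular) auto
    moreover have "(S \<union> T) \<union> (U \<union> T) = S \<union> U \<union> T" "(S \<union> T) \<inter> (U \<union> T) = S \<inter> U \<union> T" by auto
    ultimately have "rk (S \<union> U \<union> T) + rk (S \<inter> U \<union> T) \<le> rk (S \<union> T) + rk (U \<union> T)" by simp
    moreover have "rk T \<le> rk (S \<inter> U \<union> T)" by (rule le) (use that in auto)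
    moreover have "rk T \<le> rk (S \<union> U \<union> T)" by (rule le) (use that in auto)
    ultimately show ?thesis using le[OF that(1)] le[OF that(2)] by linarith
  qed
qed

definition nonloops :: "'a set" where
  "nonloops = {i \<in> E. rk {i} = 1}"

definition parallel :: "('a \<times> 'a) set" where
  "parallel = {(i, j). i \<in> nonloops \<and> j \<in> nonloops \<and> rk {i, j} = 1}"

lemma rk_singleton: "i \<in> E \<Longrightarrow> rk {i} = (if i \<in> nonloops then 1 else 0)"
  using rk_le_card[of "{i}"] by (auto simp: nonloops_def)

lemma rk_pair:
  assumes "i \<in> E" "j \<in> E"
  shows "rk {i, j} = (if i \<in> nonloops \<and> j \<in> nonloops then if (i, j) \<in> parallel then 1 else 2
                      else if i \<in> nonloops \<or> j \<in> nonloops then 1 else 0)"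
proof -
  have "rk ({i} \<union> {j}) + rk ({i} \<inter> {j}) \<le> rk {i} + rk {j}"
    using assms by (intro rk_submodular) auto
  then have "rk {i, j} \<le> rk {i} + rk {j}" by (simp add: insert_commute)
  moreover have "rk {i} \<le> rk {i, j}" "rk {j} \<le> rk {i, j}"
    using assms by (auto intro!: rk_mono)
  ultimately show ?thesis
    using rk_singleton[OF assms(1)] rk_singleton[OF assms(2)] by (auto simp: parallel_def split: if_splits)
qed

lemma equiv_parallel: "equiv nonloops parallel"
proof (rule equivI)
  show "refl_on nonloops parallel" by (auto simp: refl_on_def parallel_def nonloops_def)
  show "parallel \<subseteq> nonloops \<times> nonloops" by (auto simp: parallel_def)
  show "sym parallel" by (auto simp: sym_def parallel_def insert_commute)
  show "trans parallel"
  proof (rule transI)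
    fix i j l assume "(i, j) \<in> parallel" "(j, l) \<in> parallel"
    then have *: "i \<in> nonloops" "j \<in> nonloops" "l \<in> nonloops" "rk {i, j} = 1" "rk {j, l} = 1"
      by (auto simp: parallel_def)
    then have E: "i \<in> E" "j \<in> E" "l \<in> E" "rk {j} = 1" "rk {i} = 1" by (auto simp: nonloops_def)
    have "rk ({i, j} \<union> {j, l}) + rk ({i, j} \<inter> {j, l}) \<le> rk {i, j} + rk {j, l}"
      using E by (intro rk_submodular) auto
    moreover have "rk {j} \<le> rk ({i, j} \<inter> {j, l})" using E by (intro rk_mono) auto
    moreover have "rk {i, l} \<le> rk ({i, j} \<union> {j, l})" using E by (intro rk_mono) auto
    moreover have "rk {i} \<le> rk {i, l}" using E by (intro rk_mono) auto
    ultimately have "rk {i, l} = 1" using * E by simp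
    then show "(i, l) \<in> parallel" using * by (simp add: parallel_def)
  qed
qed

end

section \<open>Bases of matroid quotients and exchange connectivity\<close>

text \<open>
  The quotient relation between two matroids on one ground set: the matroid \<open>\<rho>\<close> is a quotient
  of \<open>r\<close> if the identity is a morphism. The defining inequality is written as a sum in order to stay in
  the natural numbers.
\<close>

locale matroid_quotient = M: matroid E r + N: matroid E \<rho>
  for E :: "'a set" and r \<rho> :: "'a set \<Rightarrow> nat" +
  assumes quotient: "A \<subseteq> B \<Longrightarrow> B \<subseteq> E \<Longrightarrow> \<rho> B + r A \<le> r B + \<rho> A"
begin

definition bases :: "'a set set" where
  "bases = {S. S \<subseteq> E \<and> r S = card S \<and> \<rho> S = \<rho> E}"

lemma basesI: "S \<subseteq> E \<Longrightarrow> r S = card S \<Longrightarrow> \<rho> E \<le> \<rho> S \<Longrightarrow> S \<in> bases"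
  using N.rk_mono[of S E] by (auto simp: bases_def intro!: antisym)

lemma finite_bases: "finite bases"
  by (rule finite_subset[of _ "Pow E"]) (auto simp: bases_def M.finite_ground)

text \<open>
  Passing to a quotient cannot separate nested sets with the same closure: if \<open>A\<close> has the rank of \<open>B\<close> in \<open>r\<close>, then it has
  the rank of \<open>B\<close> in \<open>\<rho>\<close> as well.
\<close>

lemma spanning_if_rk_eq:
  assumes "A \<subseteq> B" "B \<subseteq> E" "r A = r B" "\<rho> B = \<rho> E"
  shows "\<rho> E \<le> \<rho> A"
  using quotient[OF assms(1,2)] assms(3,4) by simp

lemma contract_quotient:
  assumes T: "T \<subseteq> E"
  shows "matroid_quotient (E - T) (\<lambda>S. r (S \<union> T) - r T) (\<lambda>S. \<rho> (S \<union> T) - \<rho> T)"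
proof -
  interpret M': matroid "E - T" "\<lambda>S. r (S \<union> T) - r T" by (rule M.contract[OF T])
  interpret N': matroid "E - T" "\<lambda>S. \<rho> (S \<union> T) - \<rho> T" by (rule N.contract[OF T])
  show ?thesis
  proof
    fix A B assume AB: "A \<subseteq> B" "B \<subseteq> E - T"
    have "\<rho> (B \<union> T) + r (A \<union> T) \<le> r (B \<union> T) + \<rho> (A \<union> T)" using AB T by (intro quotient) auto
    moreover have "r T \<le> r (A \<union> T)" "r T \<le> r (B \<union> T)" "\<rho> T \<le> \<rho> (A \<union> T)" "\<rho> T \<le> \<rho> (B \<union> T)"
      using AB T by (auto intro!: M.rk_mono N.rk_mono)
    ultimately show "\<rho> (B \<union> T) - \<rho> T + (r (A \<union> T) - r T) \<le> r (B \<union> T) - r T + (\<rho> (A \<union> T) - \<rho> T)"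
      by simp
  qed
qed

text \<open>
  The bases of the contraction by an independent set \<open>T\<close> are those of the quotient pair that contain \<open>T\<close>,
  with \<open>T\<close> removed. This reduces statements about derivatives of the generating polynomial to statements
  about the polynomial itself.
\<close>

lemma bases_contract:
  assumes T: "T \<subseteq> E" "r T = card T" and S: "S \<subseteq> E - T"
  shows "S \<in> matroid_quotient.bases (E - T) (\<lambda>S. r (S \<union> T) - r T) (\<lambda>S. \<rho> (S \<union> T) - \<rho> T)
           \<longleftrightarrow> S \<union> T \<in> bases"
proof -
  have "finite S" "finite T" using S T M.finite_ground by (auto intro: finite_subset)
  then have "card (S \<union> T) = card S + card T" using S by (intro card_Un_disjoint) auto
  moreover have "r T \<le> r (S \<union> T)" by (rule M.rk_mono) (use S T in auto)
  moreover have "\<rho> T \<le> \<rho> (S \<union> T)" "\<rho> T \<le> \<rho> E"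
    using S T by (auto intro!: N.rk_mono)
  moreover have "E - T \<union> T = E" "S \<subseteq> E" using S T by auto
  ultimately show ?thesis
    unfolding matroid_quotient.bases_def[OF contract_quotient[OF T(1)]] bases_def
    using T S by auto
qed

text \<open>
  A single exchange connects \<open>i\<close> and \<open>j\<close>: either they lie together in \<open>A\<close>, or \<open>A\<close> is \<open>S\<close> with \<open>i\<close> replaced
  by \<open>j\<close>, and then any other element of \<open>S\<close> is a common neighbour.
\<close>

lemma exchange_edge:
  fixes y :: "'a option \<Rightarrow> real"
  assumes edge: "\<And>i j S. S \<in> bases \<Longrightarrow> card S \<le> m \<Longrightarrow> i \<in> S \<Longrightarrow> j \<in> S \<Longrightarrow> i \<noteq> j \<Longrightarrow> y (Some i) = y (Some j)"
    and S: "S \<in> bases" "card S \<le> m" "2 \<le> card S" "i \<in> S" "j \<notin> S"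
    and A: "A \<in> bases" "j \<in> A" "A \<subseteq> insert j S" "card A = card S"
  shows "y (Some i) = y (Some j)"
proof (cases "i \<in> A")
  case True
  then show ?thesis using edge[of A i j] A S by auto
next
  case False
  have fS: "finite S" using S M.finite_subset_ground by (auto simp: bases_def)
  have "A \<subseteq> insert j (S - {i})" using A False by auto
  moreover have "card (insert j (S - {i})) = card S"
    using fS S by (simp add: card.remove[symmetric])
  ultimately have A_eq: "A = insert j (S - {i})"
    using A fS by (intro card_subset_eq) auto
  have "S - {i} \<noteq> {}"
  proof
    assume "S - {i} = {}"
    then have "S = {i}" using S by auto
    then show False using S by simp
  qed
  then obtain l where l: "l \<in> S" "l \<noteq> i" by auto
  have "y (Some i) = y (Some l)" using edge[of S i l] S l by auto
  also have "\<dots> = y (Some j)" using edge[of A l j] A S l A_eq by auto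
  finally show ?thesis .
qed

text \<open>
  Here \<open>None\<close> stands for the homogenising variable, which shares an edge with \<open>i\<close> if \<open>i\<close> lies in a basis of size less
  than \<open>m\<close>. If \<open>insert i S\<close> is dependent, exchanging an element of \<open>S\<close> for \<open>i\<close> gives such a basis, since it keeps
  the closure. Otherwise \<open>insert i S\<close> is itself a basis; if it is too large by one, then each element
  of \<open>S\<close> is a common neighbour of \<open>i\<close> and \<open>None\<close>.
\<close>

lemma connected_to_homogenising_variable:
  fixes y :: "'a option \<Rightarrow> real"
  assumes edge: "\<And>i j S. S \<in> bases \<Longrightarrow> card S \<le> m \<Longrightarrow> i \<in> S \<Longrightarrow> j \<in> S \<Longrightarrow> i \<noteq> j \<Longrightarrow> y (Some i) = y (Some j)"
    and edge0: "\<And>i S. S \<in> bases \<Longrightarrow> card S < m \<Longrightarrow> i \<in> S \<Longrightarrow> y None = y (Some i)"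
    and m: "2 \<le> m"
    and S: "S \<in> bases" "card S < m"
    and Si: "Si \<in> bases" "i \<in> Si"
  shows "y None = y (Some i)"
proof (cases "i \<in> S")
  case True
  then show ?thesis using edge0 S by blast
next
  case False
  have SE: "S \<subseteq> E" "r S = card S" "\<rho> S = \<rho> E" using S by (auto simp: bases_def)
  have iE: "i \<in> E" "r {i} = card {i}"
    using Si M.independent_subset[of Si "{i}"] by (auto simp: bases_def)
  have fS: "finite S" using SE M.finite_subset_ground by blast
  have span: "\<rho> (insert i S) = \<rho> E"
    using SE iE N.rk_mono[OF subset_insertI, of i S] N.rk_mono[of "insert i S" E] by auto
  show ?thesis
  proof (cases "r (insert i S) = card (insert i S)")
    case True
    then have B: "insert i S \<in> bases" using SE iE span by (intro basesI) auto
    show ?thesis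
    proof (cases "card S + 1 < m")
      case True
      then show ?thesis using edge0[OF B, of i] False fS by auto
    next
      case False': False
      then have "S \<noteq> {}" using m S by auto
      then obtain j where j: "j \<in> S" by blast
      have "y None = y (Some j)" using edge0 S j by blast
      also have "\<dots> = y (Some i)" using edge[OF B, of j i] False j fS S by auto
      finally show ?thesis .
    qed
  next
    case dep: False
    have "r (insert i S) \<le> card (insert i S)" by (rule M.rk_le_card) (use SE iE in auto)
    moreover have "r S \<le> r (insert i S)" by (rule M.rk_mono) (use SE iE in auto)
    ultimately have rk: "r (insert i S) = card S" using dep False fS SE by simp
    obtain A where A: "{i} \<subseteq> A" "A \<subseteq> insert i S" "r A = card A" "card A = r (insert i S)"
      using M.independent_extend[of "{i}" "insert i S"] SE iE by auto
    have "\<rho> E \<le> \<rho> A"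
      using A SE iE span by (intro spanning_if_rk_eq[of A "insert i S"]) auto
    then have "A \<in> bases" using A SE iE by (intro basesI) auto
    then show ?thesis using edge0[of A i] A rk S by auto
  qed
qed

text \<open>
  If some basis has size less than \<open>m\<close>, both elements are connected to the homogenising variable.
  Otherwise all bases of size at most \<open>m\<close> have size exactly \<open>m\<close> and are bases of the quotient \<open>\<rho>\<close> as well, because
  every one of them contains a basis of \<open>\<rho>\<close>, which cannot be smaller. The exchange of \<open>j\<close> into \<open>Si\<close> is carried out in \<open>r\<close> if
  \<open>insert j Si\<close> is dependent there, and in \<open>\<rho>\<close> if it is not.
\<close>

lemma connected:
  fixes y :: "'a option \<Rightarrow> real"
  assumes edge: "\<And>i j S. S \<in> bases \<Longrightarrow> card S \<le> m \<Longrightarrow> i \<in> S \<Longrightarrow> j \<in> S \<Longrightarrow> i \<noteq> j \<Longrightarrow> y (Some i) = y (Some j)"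
    and edge0: "\<And>i S. S \<in> bases \<Longrightarrow> card S < m \<Longrightarrow> i \<in> S \<Longrightarrow> y None = y (Some i)"
    and m: "2 \<le> m"
    and Si: "Si \<in> bases" "i \<in> Si" "card Si \<le> m"
    and Sj: "Sj \<in> bases" "j \<in> Sj" "card Sj \<le> m"
  shows "y (Some i) = y (Some j)"
proof (cases "\<exists>S\<in>bases. card S < m")
  case True
  then obtain S where S: "S \<in> bases" "card S < m" by blast
  have "y None = y (Some l)" if "Sl \<in> bases" "l \<in> Sl" for l Sl
    by (rule connected_to_homogenising_variable[where S = S and Si = Sl, OF _ _ m S that])
      (blast intro: edge edge0)+
  from this[OF Si(1,2)] this[OF Sj(1,2)]
  show ?thesis by simp
next
  case False
  then have size: "card S = m" if "S \<in> bases" "card S \<le> m" for S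
    using that by force
  show ?thesis
  proof (cases "j \<in> Si")
    case True
    then show ?thesis using edge Si by blast
  next
    case jSi: False
    have SiE: "Si \<subseteq> E" "r Si = card Si" "\<rho> Si = \<rho> E" using Si by (auto simp: bases_def)
    have jE: "j \<in> E" "r {j} = card {j}"
      using Sj M.independent_subset[of Sj "{j}"] by (auto simp: bases_def)
    have fSi: "finite Si" using SiE M.finite_subset_ground by blast
    have span: "\<rho> (insert j Si) = \<rho> E"
      using SiE jE N.rk_mono[OF subset_insertI, of j Si] N.rk_mono[of "insert j Si" E] by auto
    have N_indep: "\<rho> S = card S" if "S \<in> bases" "card S \<le> m" for S
    proof -
      have SE: "S \<subseteq> E" "r S = card S" "\<rho> S = \<rho> E" using that by (auto simp: bases_def)
      obtain Y where Y: "Y \<subseteq> S" "\<rho> Y = card Y" "card Y = \<rho> S"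
        using N.independent_extend[of "{}" S] SE by auto
      have "Y \<in> bases"
        using Y SE M.independent_subset[of S Y] by (intro basesI) auto
      moreover have "card Y \<le> card S"
        using Y SE M.finite_subset_ground by (intro card_mono) auto
      ultimately have "card Y = m" using size that by force
      then show ?thesis using size[OF that] Y by simp
    qed
    have "\<exists>A\<in>bases. j \<in> A \<and> A \<subseteq> insert j Si \<and> card A = card Si"
    proof (cases "r (insert j Si) = card (insert j Si)")
      case True
      have "\<rho> {j} = card {j}"
        using N.independent_subset[of Sj "{j}"] N_indep[of Sj] Sj by (auto simp: bases_def)
      then obtain A where A: "{j} \<subseteq> A" "A \<subseteq> insert j Si" "\<rho> A = card A" "card A = \<rho> (insert j Si)"
        using N.independent_extend[of "{j}" "insert j Si"] SiE jE by auto
      have "A \<in> bases"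
        using A SiE jE span True M.independent_subset[of "insert j Si" A] by (intro basesI) auto
      moreover have "card A = card Si" using A span SiE N_indep[of Si] Si by simp
      ultimately show ?thesis using A by auto
    next
      case dep: False
      have "r (insert j Si) \<le> card (insert j Si)" by (rule M.rk_le_card) (use SiE jE in auto)
      moreover have "r Si \<le> r (insert j Si)" by (rule M.rk_mono) (use SiE jE in auto)
      ultimately have rk: "r (insert j Si) = card Si" using dep jSi fSi SiE by simp
      obtain A where A: "{j} \<subseteq> A" "A \<subseteq> insert j Si" "r A = card A" "card A = r (insert j Si)"
        using M.independent_extend[of "{j}" "insert j Si"] SiE jE by auto
      have "\<rho> E \<le> \<rho> A"
        using A SiE jE span by (intro spanning_if_rk_eq[of A "insert j Si"]) auto
      then have "A \<in> bases" using A SiE jE by (intro basesI) auto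
      then show ?thesis using A rk by auto
    qed
    then obtain A where A: "A \<in> bases" "j \<in> A" "A \<subseteq> insert j Si" "card A = card Si" by blast
    have "2 \<le> card Si" using size[of Si] Si m by simp
    then show ?thesis
      by (intro exchange_edge[of m y Si i j A] edge) (use A Si jSi in auto)
  qed
qed

end

section \<open>Links of rank two\<close>

text \<open>
  The double sum is the sum of the squares of the sums over the classes, so this is the Cauchy-Schwarz
  inequality, with the number of classes bounded by the number of elements.
\<close>

lemma equivalence_form_ge_square:
  fixes x :: "'a \<Rightarrow> real"
  assumes fin: "finite L" and R: "equiv L R"
  shows "(\<Sum>i\<in>L. x i)\<^sup>2 \<le> real (card L) * (\<Sum>i\<in>L. \<Sum>j\<in>L. if (i, j) \<in> R then x i * x j else 0)"
proof -
  have finQ: "finite (L // R)" "\<And>C. C \<in> L // R \<Longrightarrow> finite C"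
    using finite_quotient[OF fin equiv_type[OF R]] finite_equiv_class[OF fin equiv_type[OF R]] by auto
  have split: "(\<Sum>i\<in>L. f i) = (\<Sum>C\<in>L // R. \<Sum>i\<in>C. f i)" for f :: "'a \<Rightarrow> real"
  proof -
    have "sum f (\<Union>(L // R)) = (\<Sum>C\<in>L // R. \<Sum>i\<in>C. f i)"
      using finQ quotient_disj[OF R] by (subst sum.Union_disjoint) auto
    then show ?thesis by (simp add: Union_quotient[OF R])
  qed
  have "(\<Sum>i\<in>L. \<Sum>j\<in>L. if (i, j) \<in> R then x i * x j else 0) = (\<Sum>C\<in>L // R. (\<Sum>i\<in>C. x i)\<^sup>2)"
    unfolding split
  proof (intro sum.cong refl)
    fix C assume C: "C \<in> L // R"
    have "(\<Sum>j\<in>L. if (i, j) \<in> R then x i * x j else 0) = x i * (\<Sum>j\<in>C. x j)" if "i \<in> C" for i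
    proof -
      have CR: "C = R `` {i}" using C that R
        by (metis Image_singleton_iff equiv_class_eq_iff quotientE)
      have "(\<Sum>j\<in>L. if (i, j) \<in> R then x i * x j else 0) = (\<Sum>j\<in>{j \<in> L. (i, j) \<in> R}. x i * x j)"
        using fin by (simp add: sum.inter_filter)
      also have "{j \<in> L. (i, j) \<in> R} = C"
        using CR R by (auto simp: equiv_def)
      finally show ?thesis by (simp add: sum_distrib_left)
    qed
    then have "(\<Sum>i\<in>C. \<Sum>j\<in>L. if (i, j) \<in> R then x i * x j else 0) = (\<Sum>i\<in>C. x i * (\<Sum>j\<in>C. x j))"
      by (intro sum.cong refl)
    also have "\<dots> = (\<Sum>i\<in>C. x i)\<^sup>2"
      by (simp add: sum_distrib_right[symmetric] power2_eq_square)
    finally show "(\<Sum>i\<in>C. \<Sum>C\<in>L // R. \<Sum>j\<in>C. if (i, j) \<in> R then x i * x j else 0) = (\<Sum>i\<in>C. x i)\<^sup>2"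
      unfolding split .
  qed
  moreover have "(\<Sum>i\<in>L. x i)\<^sup>2 \<le> real (card (L // R)) * (\<Sum>C\<in>L // R. (\<Sum>i\<in>C. x i)\<^sup>2)"
    unfolding split[of x]
    using sum_squared_le_sum_of_squares[of "\<lambda>C. \<Sum>i\<in>C. x i" "L // R"] finQ(1)
    by (simp add: mult.commute)
  moreover have "real (card (L // R)) * (\<Sum>C\<in>L // R. (\<Sum>i\<in>C. x i)\<^sup>2)
      \<le> real (card L) * (\<Sum>C\<in>L // R. (\<Sum>i\<in>C. x i)\<^sup>2)"
  proof (intro mult_right_mono sum_nonneg)
    have "L // R = (\<lambda>i. R `` {i}) ` L" by (auto simp: quotient_def)
    then show "real (card (L // R)) \<le> real (card L)" using card_image_le[OF fin] by simp
  qed auto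
  ultimately show ?thesis by (simp only:)
qed

lemma bilin_insert_None:
  assumes "finite E"
  shows "bilin (insert None (Some ` E)) A x x
    = A None None * (x None)\<^sup>2 + x None * (\<Sum>i\<in>E. (A None (Some i) + A (Some i) None) * x (Some i))
      + (\<Sum>i\<in>E. \<Sum>j\<in>E. A (Some i) (Some j) * x (Some i) * x (Some j))"
proof -
  have "sum f (insert None (Some ` E)) = f None + (\<Sum>i\<in>E. f (Some i))" for f :: "'a option \<Rightarrow> real"
    using assms by (subst sum.insert) (auto simp: sum.reindex)
  then show ?thesis
    unfolding bilin_def
    by (simp add: sum.distrib sum_distrib_left power2_eq_square algebra_simps)
qed

context matroid_quotient
begin

text \<open>
  For a ground set with \<open>k + 2\<close> elements, this is the Hessian of the quadratic polynomial that is left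
  when the homogenised generating polynomial of the bases, which has degree \<open>k + 2\<close>, is differentiated \<open>k\<close> times in the homogenising variable, up to the common factor
  \<open>fact k\<close>.
\<close>

fun rank_two_link :: "nat \<Rightarrow> 'a option \<Rightarrow> 'a option \<Rightarrow> real" where
  "rank_two_link k None None = (if {} \<in> bases then real (k + 2) * real (k + 1) else 0)"
| "rank_two_link k None (Some j) = (if {j} \<in> bases then real (k + 1) else 0)"
| "rank_two_link k (Some i) None = (if {i} \<in> bases then real (k + 1) else 0)"
| "rank_two_link k (Some i) (Some j) = (if i \<noteq> j \<and> {i, j} \<in> bases then 1 else 0)"

text \<open>
  The case distinction is on the rank of the quotient; if it exceeds two, the form is zero. Let \<open>s\<close> be the
  sum of the variables that belong to singleton bases or, in rank two, to nonloops of the quotient, and \<open>p\<close> the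
  sum of the squares of the sums over the parallel classes among them. In rank zero the form is
  \<open>(k+2)(k+1) x\<^sub>0\<^sup>2 + 2 (k+1) x\<^sub>0 s + s\<^sup>2 - p\<close> with \<open>p \<ge> s\<^sup>2 / (k+2)\<close>, and replacing \<open>p\<close> by that bound
  completes the square. In rank one it is a product of two linear forms minus \<open>p\<close>, because elements
  that are loops of the quotient are never parallel to elements that are not. In rank two it is \<open>s\<^sup>2 - p\<close>,
  with the parallel classes of the quotient.
\<close>

lemma rank_two_link_le_square:
  assumes k: "card E = k + 2"
  shows "\<exists>c. \<forall>x. bilin (insert None (Some ` E)) (rank_two_link k) x x
                 \<le> (\<Sum>u\<in>insert None (Some ` E). c u * x u)\<^sup>2"
proof -
  have fin: "finite E" by (rule M.finite_ground)
  have sumI: "sum f (insert None (Some ` E)) = f None + (\<Sum>i\<in>E. f (Some i))" for f :: "'a option \<Rightarrow> real"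
    using fin by (subst sum.insert) (auto simp: sum.reindex)
  define ind where "ind L i = (if i \<in> L then 1 else 0 :: real)" for L :: "'a set" and i
  have ind_sum: "(\<Sum>i\<in>E. ind L i * x (Some i)) = (\<Sum>i\<in>L. x (Some i))" if "L \<subseteq> E" for L and x :: "'a option \<Rightarrow> real"
  proof -
    have "(\<Sum>i\<in>E. ind L i * x (Some i)) = (\<Sum>i\<in>L. ind L i * x (Some i))"
      using fin that by (intro sum.mono_neutral_right) (auto simp: ind_def)
    then show ?thesis by (simp add: ind_def)
  qed
  have ind_sum2: "(\<Sum>i\<in>E. \<Sum>j\<in>E. ind L i * ind L' j * x (Some i) * x (Some j))
      = (\<Sum>i\<in>L. x (Some i)) * (\<Sum>i\<in>L'. x (Some i))" if "L \<subseteq> E" "L' \<subseteq> E" for L L' and x :: "'a option \<Rightarrow> real"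
    unfolding ind_sum[OF that(1), symmetric] ind_sum[OF that(2), symmetric] sum_product
    by (intro sum.cong) auto
  have par_sum: "(\<Sum>i\<in>E. \<Sum>j\<in>E. (if i \<in> L \<and> j \<in> L \<and> (i, j) \<in> R then 1 else 0) * x (Some i) * x (Some j))
      = (\<Sum>i\<in>L. \<Sum>j\<in>L. if (i, j) \<in> R then x (Some i) * x (Some j) else 0)" (is "?l = ?r")
    if "L \<subseteq> E" for L R and x :: "'a option \<Rightarrow> real"
  proof -
    have "?l = (\<Sum>i\<in>L. \<Sum>j\<in>E. (if i \<in> L \<and> j \<in> L \<and> (i, j) \<in> R then 1 else 0) * x (Some i) * x (Some j))"
      using fin that by (intro sum.mono_neutral_right) auto
    also have "\<dots> = (\<Sum>i\<in>L. \<Sum>j\<in>L. (if i \<in> L \<and> j \<in> L \<and> (i, j) \<in> R then 1 else 0) * x (Some i) * x (Some j))"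
      using fin that by (intro sum.cong refl sum.mono_neutral_right) auto
    also have "\<dots> = ?r" by (intro sum.cong) auto
    finally show ?thesis .
  qed
  have \<rho>_le_r: "\<rho> S \<le> r S" if "S \<subseteq> E" for S using quotient[of "{}" S] that by simp
  have nlM: "M.nonloops \<subseteq> E" and nlN: "N.nonloops \<subseteq> E"
    by (auto simp: M.nonloops_def N.nonloops_def)
  have emp: "{} \<in> bases \<longleftrightarrow> \<rho> E = 0" by (auto simp: bases_def)
  have single: "{i} \<in> bases \<longleftrightarrow> i \<in> M.nonloops \<and> \<rho> E = \<rho> {i}" if "i \<in> E" for i
    using that by (auto simp: bases_def M.nonloops_def)
  have pair: "{i, j} \<in> bases \<longleftrightarrow> i \<in> M.nonloops \<and> j \<in> M.nonloops \<and> (i, j) \<notin> M.parallel \<and> \<rho> E = \<rho> {i, j}"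
    if "i \<in> E" "j \<in> E" "i \<noteq> j" for i j
    using that M.rk_pair[OF that(1,2)] by (auto simp: bases_def split: if_splits)
  have reflM: "(i, i) \<in> M.parallel \<longleftrightarrow> i \<in> M.nonloops" for i
    by (auto simp: M.parallel_def M.nonloops_def)
  have reflN: "(i, i) \<in> N.parallel \<longleftrightarrow> i \<in> N.nonloops" for i
    by (auto simp: N.parallel_def N.nonloops_def)
  have nlNM: "N.nonloops \<subseteq> M.nonloops"
  proof
    fix i assume "i \<in> N.nonloops"
    then show "i \<in> M.nonloops"
      using \<rho>_le_r[of "{i}"] M.rk_singleton[of i] by (auto simp: N.nonloops_def split: if_splits)
  qed
  consider "\<rho> E = 0" | "\<rho> E = 1" | "\<rho> E = 2" | "\<rho> E > 2" by linarith
  then show ?thesis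
  proof cases
    case 1
    let ?L = "M.nonloops"
    define a where "a = real (k + 1) / real (k + 2)"
    have \<rho>0: "\<rho> S = 0" if "S \<subseteq> E" for S using N.rk_mono[of S E] that 1 by simp
    have e_pair: "rank_two_link k (Some i) (Some j) = ind ?L i * ind ?L j - (if i \<in> ?L \<and> j \<in> ?L \<and> (i, j) \<in> M.parallel then 1 else 0)"
      if "i \<in> E" "j \<in> E" for i j
      using that pair[of i j] 1 \<rho>0[of "{i, j}"] reflM by (cases "i = j") (auto simp: ind_def)
    have "bilin (insert None (Some ` E)) (rank_two_link k) x x
        \<le> (\<Sum>u\<in>insert None (Some ` E). (case u of None \<Rightarrow> sqrt a * real (k + 2) | Some i \<Rightarrow> sqrt a * ind ?L i) * x u)\<^sup>2" for x
    proof -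
      define s where "s = (\<Sum>i\<in>?L. x (Some i))"
      define p where "p = (\<Sum>i\<in>?L. \<Sum>j\<in>?L. if (i, j) \<in> M.parallel then x (Some i) * x (Some j) else 0)"
      have "(\<Sum>i\<in>E. \<Sum>j\<in>E. rank_two_link k (Some i) (Some j) * x (Some i) * x (Some j)) = s * s - p"
        unfolding s_def p_def ind_sum2[OF nlM nlM, symmetric] par_sum[OF nlM, symmetric] sum_subtractf[symmetric]
        by (intro sum.cong refl) (simp only: e_pair left_diff_distrib)
      moreover have "(\<Sum>i\<in>E. (rank_two_link k None (Some i) + rank_two_link k (Some i) None) * x (Some i))
          = 2 * real (k + 1) * s"
        unfolding s_def ind_sum[OF nlM, symmetric] sum_distrib_left
        using 1 \<rho>0 by (intro sum.cong refl) (auto simp: single ind_def)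
      ultimately have q: "bilin (insert None (Some ` E)) (rank_two_link k) x x
          = real (k + 2) * real (k + 1) * (x None)\<^sup>2 + x None * (2 * real (k + 1) * s) + (s * s - p)"
        using bilin_insert_None[OF fin, of "rank_two_link k" x] 1 emp by simp
      have fL: "finite ?L" using nlM fin finite_subset by blast
      have sp: "s\<^sup>2 \<le> real (card ?L) * p"
        unfolding s_def p_def using equivalence_form_ge_square[OF fL M.equiv_parallel, of "\<lambda>i. x (Some i)"] .
      have "s\<^sup>2 \<le> real (k + 2) * p"
      proof -
        have "0 \<le> p"
        proof (cases "card ?L = 0")
          case True then show ?thesis using fL by (simp add: p_def)
        next
          case False
          have "0 \<le> real (card ?L) * p" using sp zero_le_power2[of s] by linarith
          then show ?thesis using False by (simp add: zero_le_mult_iff)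
        qed
        moreover have "card ?L \<le> k + 2" using card_mono[OF fin nlM] k by simp
        ultimately have "real (card ?L) * p \<le> real (k + 2) * p" by (intro mult_right_mono) auto
        then show ?thesis using sp by linarith
      qed
      then have "s\<^sup>2 / real (k + 2) \<le> p" by (simp add: field_simps)
      moreover have "real (k + 2) * real (k + 1) * (x None)\<^sup>2 + x None * (2 * real (k + 1) * s) + (s * s - s\<^sup>2 / real (k + 2))
          = a * (real (k + 2) * x None + s)\<^sup>2"
      proof -
        have "real (k + 2) > 0" by simp
        then show ?thesis
          unfolding a_def by (simp add: field_simps power2_eq_square)
      qed
      ultimately have "bilin (insert None (Some ` E)) (rank_two_link k) x x \<le> a * (real (k + 2) * x None + s)\<^sup>2"
        using q by linarith
      moreover have "(\<Sum>u\<in>insert None (Some ` E). (case u of None \<Rightarrow> sqrt a * real (k + 2) | Some i \<Rightarrow> sqrt a * ind ?L i) * x u)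
          = sqrt a * (real (k + 2) * x None + s)"
        unfolding sumI s_def ind_sum[OF nlM, symmetric]
        by (simp add: distrib_left sum_distrib_left mult.assoc)
      moreover have "(sqrt a * (real (k + 2) * x None + s))\<^sup>2 = a * (real (k + 2) * x None + s)\<^sup>2"
        by (simp add: power_mult_distrib a_def)
      ultimately show ?thesis by (simp only:)
    qed
    then show ?thesis by blast
  next
    case 2
    let ?L = "N.nonloops" and ?L' = "M.nonloops - N.nonloops"
    have L': "?L' \<subseteq> E" using nlM by auto
    have s1: "{i} \<in> bases \<longleftrightarrow> i \<in> ?L" if "i \<in> E" for i
      using single[OF that] N.rk_singleton[OF that] 2 nlNM by auto
    have N_pair: "\<rho> {i, j} = 1 \<longleftrightarrow> i \<in> ?L \<or> j \<in> ?L" if "i \<in> E" "j \<in> E" for i j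
      using N.rk_mono[of "{i, j}" E] N.rk_pair[OF that] that 2 by (auto split: if_splits)
    \<comment> \<open>Parallel elements have the same closure in \<open>r\<close>, hence the same rank in \<open>\<rho>\<close>.\<close>
    have par: "i \<in> ?L \<longleftrightarrow> j \<in> ?L" if "(i, j) \<in> M.parallel" for i j
    proof -
      have *: "i' \<in> ?L" if "(i', j') \<in> M.parallel" "j' \<in> ?L" for i' j'
      proof -
        have E: "i' \<in> E" "j' \<in> E" "r {i', j'} = 1" "r {i'} = 1"
          using that by (auto simp: M.parallel_def M.nonloops_def)
        have "\<rho> {i', j'} + r {i'} \<le> r {i', j'} + \<rho> {i'}" using E by (intro quotient) auto
        moreover have "\<rho> {j'} \<le> \<rho> {i', j'}" using E by (intro N.rk_mono) auto
        moreover have "\<rho> {j'} = 1" using that by (auto simp: N.nonloops_def)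
        ultimately show ?thesis using E N.rk_singleton[of i'] by (auto split: if_splits)
      qed
      have "(j, i) \<in> M.parallel" using that by (auto simp: M.parallel_def insert_commute)
      then show ?thesis using * that by blast
    qed
    have e_pair: "rank_two_link k (Some i) (Some j) = ind ?L i * ind ?L j + ind ?L i * ind ?L' j + ind ?L' i * ind ?L j
         - (if i \<in> ?L \<and> j \<in> ?L \<and> (i, j) \<in> M.parallel then 1 else 0)"
      if "i \<in> E" "j \<in> E" for i j
      using that pair[of i j] 2 N_pair[of i j] reflM[of i] par[of i j] nlNM
      by (cases "i = j"; cases "i \<in> ?L"; cases "j \<in> ?L"; cases "(i, j) \<in> M.parallel") (auto simp: ind_def)
    have "bilin (insert None (Some ` E)) (rank_two_link k) x x
        \<le> (\<Sum>u\<in>insert None (Some ` E). (case u of None \<Rightarrow> real (k + 1) / sqrt 2 | Some i \<Rightarrow> (3 / 2 * ind ?L i + ind ?L' i) / sqrt 2) * x u)\<^sup>2" for x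
    proof -
      define s where "s = (\<Sum>i\<in>?L. x (Some i))"
      define t where "t = (\<Sum>i\<in>?L'. x (Some i))"
      \<comment> \<open>The form is \<open>2 s y - p\<close>, and \<open>2 s y \<le> (s + y)\<^sup>2 / 2\<close>.\<close>
      define y where "y = real (k + 1) * x None + s / 2 + t"
      define p where "p = (\<Sum>i\<in>?L. \<Sum>j\<in>?L. if (i, j) \<in> M.parallel then x (Some i) * x (Some j) else 0)"
      have "(\<Sum>i\<in>E. \<Sum>j\<in>E. rank_two_link k (Some i) (Some j) * x (Some i) * x (Some j)) = s * s + s * t + t * s - p"
        unfolding s_def t_def p_def ind_sum2[OF nlN nlN, symmetric] ind_sum2[OF nlN L', symmetric] ind_sum2[OF L' nlN, symmetric]
          par_sum[OF nlN, symmetric] sum_subtractf[symmetric] sum.distrib[symmetric]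
        by (intro sum.cong refl) (simp only: e_pair left_diff_distrib distrib_right)
      moreover have "(\<Sum>i\<in>E. (rank_two_link k None (Some i) + rank_two_link k (Some i) None) * x (Some i))
          = 2 * real (k + 1) * s"
        unfolding s_def ind_sum[OF nlN, symmetric] sum_distrib_left
        by (intro sum.cong refl) (auto simp: s1 ind_def)
      ultimately have q: "bilin (insert None (Some ` E)) (rank_two_link k) x x = 2 * s * y - p"
        using bilin_insert_None[OF fin, of "rank_two_link k" x] 2 emp by (simp add: y_def algebra_simps)
      have fL: "finite ?L" using nlN fin finite_subset by blast
      have "0 \<le> p"
      proof -
        define R where "R = M.parallel \<inter> ?L \<times> ?L"
        have "equiv ?L R"
          using M.equiv_parallel nlNM unfolding R_def equiv_def refl_on_def sym_def trans_def by blast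
        moreover have "p = (\<Sum>i\<in>?L. \<Sum>j\<in>?L. if (i, j) \<in> R then x (Some i) * x (Some j) else 0)"
          unfolding p_def R_def by (intro sum.cong refl) auto
        ultimately have "s\<^sup>2 \<le> real (card ?L) * p"
          unfolding s_def using equivalence_form_ge_square[OF fL, of R "\<lambda>i. x (Some i)"] by simp
        then have "0 \<le> real (card ?L) * p" using zero_le_power2[of s] by linarith
        then show ?thesis
          by (cases "card ?L = 0") (use fL in \<open>auto simp: p_def zero_le_mult_iff\<close>)
      qed
      moreover have "(\<Sum>u\<in>insert None (Some ` E). (case u of None \<Rightarrow> real (k + 1) / sqrt 2 | Some i \<Rightarrow> (3 / 2 * ind ?L i + ind ?L' i) / sqrt 2) * x u)
          = (s + y) / sqrt 2"
      proof -
        have eq: "(\<Sum>i\<in>E. (3 / 2 * ind ?L i + ind ?L' i) / sqrt 2 * x (Some i)) = (3 / 2 * s + t) / sqrt 2"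
          unfolding s_def t_def ind_sum[OF nlN, symmetric] ind_sum[OF L', symmetric]
            sum_distrib_left sum.distrib[symmetric] sum_divide_distrib
          by (intro sum.cong refl) (simp add: algebra_simps)
        show ?thesis unfolding sumI option.case eq y_def by (simp add: field_simps)
      qed
      moreover have "2 * s * y \<le> ((s + y) / sqrt 2)\<^sup>2"
      proof -
        have "((s + y) / sqrt 2)\<^sup>2 - 2 * s * y = (s - y)\<^sup>2 / 2"
          by (simp add: power_divide power2_eq_square field_simps)
        then show ?thesis by (metis diff_ge_0_iff_ge divide_nonneg_pos zero_le_power2 zero_less_numeral)
      qed
      ultimately show ?thesis using q by simp
    qed
    then show ?thesis by blast
  next
    case 3
    let ?L = "N.nonloops"
    have s1: "{i} \<notin> bases" if "i \<in> E" for i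
      using single[OF that] N.rk_singleton[OF that] 3 by auto
    have e_pair: "rank_two_link k (Some i) (Some j) = ind ?L i * ind ?L j - (if i \<in> ?L \<and> j \<in> ?L \<and> (i, j) \<in> N.parallel then 1 else 0)"
      if "i \<in> E" "j \<in> E" for i j
    proof (cases "i = j")
      case True
      then show ?thesis using reflN by (auto simp: ind_def)
    next
      case False
      have "{i, j} \<in> bases \<longleftrightarrow> \<rho> {i, j} = 2"
        using \<rho>_le_r[of "{i, j}"] M.rk_le_card[of "{i, j}"] that False 3 by (auto simp: bases_def)
      then show ?thesis using N.rk_pair[OF that] False by (auto simp: ind_def split: if_splits)
    qed
    have "bilin (insert None (Some ` E)) (rank_two_link k) x x
        \<le> (\<Sum>u\<in>insert None (Some ` E). (case u of None \<Rightarrow> 0 | Some i \<Rightarrow> ind ?L i) * x u)\<^sup>2" for x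
    proof -
      define s where "s = (\<Sum>i\<in>?L. x (Some i))"
      define p where "p = (\<Sum>i\<in>?L. \<Sum>j\<in>?L. if (i, j) \<in> N.parallel then x (Some i) * x (Some j) else 0)"
      have "(\<Sum>i\<in>E. \<Sum>j\<in>E. rank_two_link k (Some i) (Some j) * x (Some i) * x (Some j)) = s * s - p"
        unfolding s_def p_def ind_sum2[OF nlN nlN, symmetric] par_sum[OF nlN, symmetric] sum_subtractf[symmetric]
        by (intro sum.cong refl) (simp only: e_pair left_diff_distrib)
      moreover have "(\<Sum>i\<in>E. (rank_two_link k None (Some i) + rank_two_link k (Some i) None) * x (Some i)) = 0"
        using s1 by (intro sum.neutral) auto
      ultimately have q: "bilin (insert None (Some ` E)) (rank_two_link k) x x = s * s - p"
        using bilin_insert_None[OF fin, of "rank_two_link k" x] 3 emp by simp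
      have fL: "finite ?L" using nlN fin finite_subset by blast
      have "s\<^sup>2 \<le> real (card ?L) * p"
        unfolding s_def p_def using equivalence_form_ge_square[OF fL N.equiv_parallel, of "\<lambda>i. x (Some i)"] .
      then have "0 \<le> real (card ?L) * p" using zero_le_power2[of s] by linarith
      then have "0 \<le> p"
        by (cases "card ?L = 0") (use fL in \<open>auto simp: p_def zero_le_mult_iff\<close>)
      then show ?thesis using q unfolding sumI s_def ind_sum[OF nlN, symmetric]
        by (simp add: power2_eq_square)
    qed
    then show ?thesis by blast
  next
    case 4
    have "S \<notin> bases" if "card S \<le> 2" for S
      using that \<rho>_le_r[of S] M.rk_le_card[of S] 4 by (force simp: bases_def)
    then have "rank_two_link k u v = 0" for u v
      by (cases "(k, u, v)" rule: rank_two_link.cases) (auto simp: card_insert_if)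
    then show ?thesis by (intro exI[of _ "\<lambda>_. 0"]) (simp add: bilin_def)
  qed
qed

end

section \<open>Scaled derivatives of homogeneous polynomials\<close>

definition falling_factorial :: "nat \<Rightarrow> nat \<Rightarrow> real" where
  "falling_factorial a k = (\<Prod>t<k. real a - real t)"

lemma falling_factorial_0 [simp]: "falling_factorial a 0 = 1"
  by (simp add: falling_factorial_def)

lemma falling_factorial_Suc: "falling_factorial a (Suc k) = falling_factorial a k * (real a - real k)"
  by (simp add: falling_factorial_def)

lemma falling_factorial_eq_0: "a < k \<Longrightarrow> falling_factorial a k = 0"
  by (auto simp: falling_factorial_def)

lemma falling_factorial_pos: "k \<le> a \<Longrightarrow> 0 < falling_factorial a k"
  by (auto simp: falling_factorial_def intro!: prod_pos)

lemma falling_factorial_nonneg: "0 \<le> falling_factorial a k"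
  using falling_factorial_eq_0[of a k] falling_factorial_pos[of k a] by (cases "a < k") auto

lemma falling_factorial_self: "falling_factorial a a = fact a"
proof (induction a)
  case (Suc a)
  have "falling_factorial (Suc a) (Suc a) = real (Suc a) * falling_factorial a a"
    unfolding falling_factorial_def by (subst prod.lessThan_Suc_shift) simp
  then show ?case using Suc by simp
qed simp

text \<open>
  For the polynomial whose monomials, indexed by \<open>s\<close>, have the exponents \<open>e s\<close> and take the values
  \<open>c s\<close> at some point, this is its derivative of order \<open>\<alpha>\<close> at that point, multiplied by the monomial
  with exponent \<open>\<alpha>\<close>. The factor rescales the coordinates so that the point becomes the all-one vector.
\<close>

definition scaled_derivative :: "'i set \<Rightarrow> 's set \<Rightarrow> ('s \<Rightarrow> real) \<Rightarrow> ('s \<Rightarrow> 'i \<Rightarrow> nat) \<Rightarrow> 'i multiset \<Rightarrow> real" where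
  "scaled_derivative I P c e \<alpha> = (\<Sum>s\<in>P. c s * (\<Prod>u\<in>I. falling_factorial (e s u) (count \<alpha> u)))"

lemma size_eq_sum_count:
  assumes "finite I" "set_mset \<alpha> \<subseteq> I"
  shows "size \<alpha> = (\<Sum>u\<in>I. count \<alpha> u)"
  unfolding size_multiset_overloaded_eq
  using assms by (intro sum.mono_neutral_left) (auto simp: not_in_iff)

text \<open>
  Differentiating once more by \<open>i\<close> multiplies the term of \<open>s\<close> by \<open>e s i - count \<alpha> i\<close>, and these factors add up
  to the degree of the derivative.
\<close>

lemma scaled_derivative_euler:
  assumes fin: "finite I" and \<alpha>: "set_mset \<alpha> \<subseteq> I" "size \<alpha> \<le> n"
    and hom: "\<And>s. s \<in> P \<Longrightarrow> (\<Sum>u\<in>I. e s u) = n"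
  shows "(\<Sum>i\<in>I. scaled_derivative I P c e (add_mset i \<alpha>)) = real (n - size \<alpha>) * scaled_derivative I P c e \<alpha>"
proof -
  define F where "F s = (\<Prod>u\<in>I. falling_factorial (e s u) (count \<alpha> u))" for s
  have step: "(\<Prod>u\<in>I. falling_factorial (e s u) (count (add_mset i \<alpha>) u)) = F s * (real (e s i) - real (count \<alpha> i))"
    if "i \<in> I" for s i
  proof -
    have "(\<Prod>u\<in>I. falling_factorial (e s u) (count (add_mset i \<alpha>) u))
        = falling_factorial (e s i) (Suc (count \<alpha> i)) * (\<Prod>u\<in>I - {i}. falling_factorial (e s u) (count (add_mset i \<alpha>) u))"
      using fin that by (subst prod.remove[of I i]) auto
    moreover have "(\<Prod>u\<in>I - {i}. falling_factorial (e s u) (count (add_mset i \<alpha>) u)) = (\<Prod>u\<in>I - {i}. falling_factorial (e s u) (count \<alpha> u))"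
      by (intro prod.cong) auto
    moreover have "F s = falling_factorial (e s i) (count \<alpha> i) * (\<Prod>u\<in>I - {i}. falling_factorial (e s u) (count \<alpha> u))"
      unfolding F_def using fin that by (subst prod.remove[of I i]) auto
    ultimately show ?thesis by (simp add: falling_factorial_Suc)
  qed
  have total: "(\<Sum>i\<in>I. real (e s i) - real (count \<alpha> i)) = real (n - size \<alpha>)" if "s \<in> P" for s
    using hom[OF that] size_eq_sum_count[OF fin \<alpha>(1)] \<alpha>(2)
    by (simp add: sum_subtractf of_nat_diff flip: of_nat_sum)
  have "(\<Sum>i\<in>I. scaled_derivative I P c e (add_mset i \<alpha>))
      = (\<Sum>i\<in>I. \<Sum>s\<in>P. c s * (F s * (real (e s i) - real (count \<alpha> i))))"
    unfolding scaled_derivative_def using step by (intro sum.cong refl) auto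
  also have "\<dots> = (\<Sum>s\<in>P. c s * F s * (\<Sum>i\<in>I. real (e s i) - real (count \<alpha> i)))"
    by (subst sum.swap) (simp add: sum_distrib_left mult.assoc)
  also have "\<dots> = (\<Sum>s\<in>P. real (n - size \<alpha>) * (c s * F s))"
    by (intro sum.cong refl) (simp add: total)
  also have "\<dots> = real (n - size \<alpha>) * scaled_derivative I P c e \<alpha>"
    unfolding scaled_derivative_def sum_distrib_left F_def ..
  finally show ?thesis .
qed

lemma scaled_derivative_nonneg:
  assumes "\<And>s. s \<in> P \<Longrightarrow> 0 \<le> c s"
  shows "0 \<le> scaled_derivative I P c e \<alpha>"
  unfolding scaled_derivative_def using assms by (intro sum_nonneg mult_nonneg_nonneg prod_nonneg) (auto simp: falling_factorial_nonneg)

lemma scaled_derivative_pos_iff: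
  assumes "finite I" "finite P" "\<And>s. s \<in> P \<Longrightarrow> 0 < c s"
  shows "0 < scaled_derivative I P c e \<alpha> \<longleftrightarrow> (\<exists>s\<in>P. \<forall>u\<in>I. count \<alpha> u \<le> e s u)"
proof
  assume "0 < scaled_derivative I P c e \<alpha>"
  then have "(\<Sum>s\<in>P. c s * (\<Prod>u\<in>I. falling_factorial (e s u) (count \<alpha> u))) \<noteq> 0"
    unfolding scaled_derivative_def by simp
  then obtain s where s: "s \<in> P" "c s * (\<Prod>u\<in>I. falling_factorial (e s u) (count \<alpha> u)) \<noteq> 0"
    by (rule sum.not_neutral_contains_not_neutral)
  then have "\<forall>u\<in>I. falling_factorial (e s u) (count \<alpha> u) \<noteq> 0"
    using assms(1) by auto
  then have "\<forall>u\<in>I. count \<alpha> u \<le> e s u" using falling_factorial_eq_0 not_le by blast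
  then show "\<exists>s\<in>P. \<forall>u\<in>I. count \<alpha> u \<le> e s u" using s by blast
next
  assume "\<exists>s\<in>P. \<forall>u\<in>I. count \<alpha> u \<le> e s u"
  then obtain s where s: "s \<in> P" "\<forall>u\<in>I. count \<alpha> u \<le> e s u" by blast
  have "0 < c s * (\<Prod>u\<in>I. falling_factorial (e s u) (count \<alpha> u))"
    using s assms by (intro mult_pos_pos prod_pos) (auto intro: falling_factorial_pos)
  also have "\<dots> \<le> scaled_derivative I P c e \<alpha>"
    unfolding scaled_derivative_def using s assms
    by (intro member_le_sum[of s P "\<lambda>s. c s * (\<Prod>u\<in>I. falling_factorial (e s u) (count \<alpha> u))"])
      (auto intro!: mult_nonneg_nonneg prod_nonneg simp: falling_factorial_nonneg less_imp_le)
  finally show "0 < scaled_derivative I P c e \<alpha>" .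
qed

section \<open>Derivatives of the homogenised basis generating polynomial\<close>

locale weighted_matroid_quotient = matroid_quotient E r \<rho>
  for E :: "'a set" and r \<rho> :: "'a set \<Rightarrow> nat" +
  fixes w :: "'a \<Rightarrow> real"
  assumes w_pos: "i \<in> E \<Longrightarrow> 0 < w i"
begin

definition vars :: "'a option set" where
  "vars = insert None (Some ` E)"

text \<open>
  \<open>None\<close> is the homogenising variable; it brings all monomials to the degree \<open>card E\<close>.
\<close>

definition exponent :: "'a set \<Rightarrow> 'a option \<Rightarrow> nat" where
  "exponent S u = (case u of None \<Rightarrow> card E - card S | Some i \<Rightarrow> if i \<in> S then 1 else 0)"

definition partial :: "'a option multiset \<Rightarrow> real" where
  "partial = scaled_derivative vars bases (\<lambda>S. \<Prod>i\<in>S. w i) exponent"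

lemma fin: "finite E" and fin_vars: "finite vars"
  using M.finite_ground by (auto simp: vars_def)

lemma basis_subset: "S \<in> bases \<Longrightarrow> S \<subseteq> E"
  by (simp add: bases_def)

lemma basis_card_le: "S \<in> bases \<Longrightarrow> card S \<le> card E"
  using card_mono[OF fin] basis_subset by blast

lemma weight_pos: "S \<subseteq> E \<Longrightarrow> 0 < (\<Prod>i\<in>S. w i)"
  using w_pos by (intro prod_pos) auto

lemma sum_vars: "(\<Sum>u\<in>vars. f u) = f None + (\<Sum>i\<in>E. f (Some i))" for f :: "'a option \<Rightarrow> 'c :: comm_monoid_add"
  unfolding vars_def using fin by (subst sum.insert) (auto simp: sum.reindex)

lemma sum_exponent:
  assumes "S \<in> bases"
  shows "(\<Sum>u\<in>vars. exponent S u) = card E"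
proof -
  have "(\<Sum>i\<in>E. exponent S (Some i)) = (\<Sum>i\<in>S. 1 :: nat)"
    using fin basis_subset[OF assms] by (intro sum.mono_neutral_cong_right) (auto simp: exponent_def)
  then show ?thesis
    using basis_card_le[OF assms] unfolding sum_vars by (simp add: exponent_def)
qed

lemma partial_nonneg: "0 \<le> partial \<alpha>"
  unfolding partial_def using weight_pos basis_subset by (intro scaled_derivative_nonneg) (auto simp: less_imp_le)

lemma partial_euler:
  "set_mset \<alpha> \<subseteq> vars \<Longrightarrow> size \<alpha> \<le> card E \<Longrightarrow>
     (\<Sum>i\<in>vars. partial (add_mset i \<alpha>)) = real (card E - size \<alpha>) * partial \<alpha>"
  unfolding partial_def by (intro scaled_derivative_euler fin_vars sum_exponent) auto

definition elems :: "'a option multiset \<Rightarrow> 'a set" where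
  "elems \<alpha> = {i. Some i \<in># \<alpha>}"

lemma count_le_exponent_iff:
  assumes "set_mset \<alpha> \<subseteq> vars" "S \<in> bases"
  shows "(\<forall>u\<in>vars. count \<alpha> u \<le> exponent S u) \<longleftrightarrow>
           (\<forall>i. count \<alpha> (Some i) \<le> 1) \<and> elems \<alpha> \<subseteq> S \<and> count \<alpha> None + card S \<le> card E"
proof -
  have out: "count \<alpha> (Some i) = 0" if "i \<notin> E" for i
    using assms(1) that by (auto simp: vars_def not_in_iff[symmetric])
  have "(\<forall>i\<in>E. count \<alpha> (Some i) \<le> exponent S (Some i)) \<longleftrightarrow> (\<forall>i. count \<alpha> (Some i) \<le> (if i \<in> S then 1 else 0))"
    using out unfolding exponent_def by (metis option.simps(5) le0)
  also have "\<dots> \<longleftrightarrow> (\<forall>i. count \<alpha> (Some i) \<le> 1) \<and> elems \<alpha> \<subseteq> S"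
  proof (intro iffI conjI allI subsetI)
    fix i assume *: "\<forall>i. count \<alpha> (Some i) \<le> (if i \<in> S then 1 else 0)"
    show "count \<alpha> (Some i) \<le> 1" using *[rule_format, of i] by (simp split: if_splits)
    show "i \<in> S" if "i \<in> elems \<alpha>"
      using *[rule_format, of i] that by (auto simp: elems_def simp flip: count_greater_zero_iff split: if_splits)
  next
    fix i assume *: "(\<forall>i. count \<alpha> (Some i) \<le> 1) \<and> elems \<alpha> \<subseteq> S"
    show "count \<alpha> (Some i) \<le> (if i \<in> S then 1 else 0)"
    proof (cases "i \<in> S")
      case True
      then show ?thesis using * by simp
    next
      case False
      then have "Some i \<notin># \<alpha>" using * by (auto simp: elems_def)
      then show ?thesis using False by (simp add: not_in_iff)
    qed
  qed
  finally show ?thesis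
    using basis_card_le[OF assms(2)] by (auto simp: vars_def exponent_def)
qed

lemma partial_pos_iff:
  assumes "set_mset \<alpha> \<subseteq> vars"
  shows "0 < partial \<alpha> \<longleftrightarrow> (\<forall>i. count \<alpha> (Some i) \<le> 1) \<and> (\<exists>S\<in>bases. elems \<alpha> \<subseteq> S \<and> count \<alpha> None + card S \<le> card E)"
proof -
  have "0 < partial \<alpha> \<longleftrightarrow> (\<exists>S\<in>bases. \<forall>u\<in>vars. count \<alpha> u \<le> exponent S u)"
    unfolding partial_def using weight_pos basis_subset by (intro scaled_derivative_pos_iff fin_vars finite_bases) auto
  also have "\<dots> \<longleftrightarrow> (\<exists>S\<in>bases. (\<forall>i. count \<alpha> (Some i) \<le> 1) \<and> elems \<alpha> \<subseteq> S \<and> count \<alpha> None + card S \<le> card E)"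
    by (intro bex_cong refl count_le_exponent_iff assms)
  finally show ?thesis by simp
qed

lemma card_elems:
  assumes "set_mset \<alpha> \<subseteq> vars" "\<And>i. count \<alpha> (Some i) \<le> 1"
  shows "count \<alpha> None + card (elems \<alpha>) = size \<alpha>" "elems \<alpha> \<subseteq> E"
proof -
  show E: "elems \<alpha> \<subseteq> E" using assms(1) by (auto simp: elems_def vars_def)
  have "(\<Sum>i\<in>E. count \<alpha> (Some i)) = (\<Sum>i\<in>elems \<alpha>. 1)"
  proof (rule sum.mono_neutral_cong_right[OF fin E])
    show "\<forall>i\<in>E - elems \<alpha>. count \<alpha> (Some i) = 0" by (auto simp: elems_def not_in_iff)
    show "count \<alpha> (Some i) = 1" if "i \<in> elems \<alpha>" for i
      using that assms(2)[of i] by (simp add: elems_def flip: count_greater_zero_iff)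
  qed
  then show "count \<alpha> None + card (elems \<alpha>) = size \<alpha>"
    unfolding size_eq_sum_count[OF fin_vars assms(1)] sum_vars by simp
qed

text \<open>
  A derivative of full order is a single coefficient times factorials: the exponents of a contributing monomial dominate \<open>\<alpha>\<close> and
  have the same sum, so they equal \<open>\<alpha>\<close>.
\<close>

lemma partial_top:
  assumes \<alpha>: "set_mset \<alpha> \<subseteq> vars" "size \<alpha> = card E"
  shows "partial \<alpha> = (if (\<forall>i. count \<alpha> (Some i) \<le> 1) \<and> elems \<alpha> \<in> bases
                 then (\<Prod>i\<in>elems \<alpha>. w i) * fact (count \<alpha> None) else 0)"
proof -
  define G where "G S = (\<Prod>i\<in>S. w i) * (\<Prod>u\<in>vars. falling_factorial (exponent S u) (count \<alpha> u))" for S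
  have zero: "G S = 0" if "S \<in> bases" "\<not> ((\<forall>i. count \<alpha> (Some i) \<le> 1) \<and> S = elems \<alpha>)" for S
  proof -
    have "\<exists>u\<in>vars. \<not> count \<alpha> u \<le> exponent S u"
    proof (rule ccontr)
      assume "\<not> (\<exists>u\<in>vars. \<not> count \<alpha> u \<le> exponent S u)"
      then have *: "\<forall>i. count \<alpha> (Some i) \<le> 1" "elems \<alpha> \<subseteq> S" "count \<alpha> None + card S \<le> card E"
        using count_le_exponent_iff[OF \<alpha>(1) that(1)] by blast+
      then have "card S \<le> card (elems \<alpha>)" using card_elems[OF \<alpha>(1)] \<alpha>(2) by fastforce
      then have "S = elems \<alpha>"
        using * card_seteq[of S "elems \<alpha>"] basis_subset[OF that(1)] fin finite_subset by blast
      then show False using * that by blast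
    qed
    then obtain u where "u \<in> vars" "exponent S u < count \<alpha> u" by (auto simp: not_le)
    then have "(\<Prod>u\<in>vars. falling_factorial (exponent S u) (count \<alpha> u)) = 0"
      using fin_vars falling_factorial_eq_0 by (intro prod_zero) auto
    then show ?thesis by (simp add: G_def)
  qed
  have YG: "partial \<alpha> = (\<Sum>S\<in>bases. G S)" by (simp add: partial_def scaled_derivative_def G_def)
  show ?thesis
  proof (cases "(\<forall>i. count \<alpha> (Some i) \<le> 1) \<and> elems \<alpha> \<in> bases")
    case False
    have "(\<Sum>S\<in>bases. G S) = 0" using zero False by (intro sum.neutral) auto
    then show ?thesis unfolding if_not_P[OF False] YG .
  next
    case True
    let ?S = "elems \<alpha>"
    have "(\<Sum>S\<in>bases. G S) = (\<Sum>S\<in>{?S}. G S)"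
      using True zero finite_bases by (intro sum.mono_neutral_right) auto
    moreover have "falling_factorial (exponent ?S u) (count \<alpha> u) = (if u = None then fact (count \<alpha> None) else 1)" if "u \<in> vars" for u
    proof (cases u)
      case None
      have "card E - card ?S = count \<alpha> None" using card_elems[OF \<alpha>(1)] True \<alpha>(2) by simp
      then show ?thesis using None falling_factorial_self by (simp add: exponent_def)
    next
      case (Some i)
      show ?thesis
      proof (cases "i \<in> ?S")
        case True': True
        then have "count \<alpha> (Some i) = 1"
          using True by (metis One_nat_def count_greater_zero_iff elems_def le_antisym less_eq_Suc_le mem_Collect_eq)
        then show ?thesis using True' Some falling_factorial_self[of 1] by (simp add: exponent_def)
      next
        case False
        then show ?thesis using Some by (simp add: elems_def not_in_iff)
      qed
    qed
    then have "(\<Prod>u\<in>vars. falling_factorial (exponent ?S u) (count \<alpha> u)) = (\<Prod>u\<in>vars. if u = None then fact (count \<alpha> None) else 1)"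
      by (intro prod.cong refl)
    moreover have "\<dots> = fact (count \<alpha> None)"
      using fin_vars by (subst prod.delta) (auto simp: vars_def)
    ultimately show ?thesis using True YG by (simp add: G_def)
  qed
qed

text \<open>
  The elements of \<open>\<alpha>\<close> form an independent set \<open>T\<close>, since some derivative of higher order is nonzero.
  Contracting \<open>T\<close> translates the claim into the connectivity of the contracted quotient, where the
  number of derivatives by the homogenising variable bounds the size of the bases.
\<close>

lemma partial_connected:
  fixes y :: "'a option \<Rightarrow> real"
  assumes \<alpha>: "set_mset \<alpha> \<subseteq> vars" "size \<alpha> + 2 \<le> card E"
    and edge: "\<And>u v. u \<in> vars \<Longrightarrow> v \<in> vars \<Longrightarrow> 0 < partial (add_mset u (add_mset v \<alpha>)) \<Longrightarrow> y u = y v"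
    and uv: "u \<in> vars" "v \<in> vars" "0 < partial (add_mset u \<alpha>)" "0 < partial (add_mset v \<alpha>)"
  shows "y u = y v"
proof -
  define T where "T = elems \<alpha>"
  define k where "k = count \<alpha> None"
  define m where "m = card E - size \<alpha>"
  have affine: "count \<alpha> (Some i) \<le> 1" for i
  proof -
    have "count (add_mset u \<alpha>) (Some i) \<le> 1"
      using uv \<alpha> partial_pos_iff[of "add_mset u \<alpha>"] by auto
    then show ?thesis by (auto split: if_splits)
  qed
  have kT: "k + card T = size \<alpha>" and TE: "T \<subseteq> E"
    using card_elems[OF \<alpha>(1) affine] by (simp_all add: k_def T_def)
  have cnt0: "count \<alpha> (Some i) = 0 \<longleftrightarrow> i \<notin> T" for i by (auto simp: T_def elems_def not_in_iff)
  obtain S0 where "S0 \<in> bases" "T \<subseteq> S0"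
    using uv \<alpha> partial_pos_iff[of "add_mset u \<alpha>"] by (auto simp: T_def elems_def)
  then have rT: "r T = card T" using M.independent_subset[of S0 T] by (auto simp: bases_def)
  interpret Q: matroid_quotient "E - T" "\<lambda>S. r (S \<union> T) - r T" "\<lambda>S. \<rho> (S \<union> T) - \<rho> T"
    by (rule contract_quotient[OF TE])
  have fT: "finite T" using TE fin finite_subset by blast
  have lift: "S \<union> T \<in> bases \<and> card (S \<union> T) = card S + card T \<and> S \<inter> T = {} \<and> S \<subseteq> E" if "S \<in> Q.bases" for S
  proof -
    have S: "S \<subseteq> E - T" using that by (simp add: Q.bases_def)
    then have "card (S \<union> T) = card S + card T"
      using fT fin finite_subset[of S E] by (intro card_Un_disjoint) auto
    then show ?thesis using bases_contract[OF TE rT S] that S by auto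
  qed
  have down: "S - T \<in> Q.bases \<and> card S = card (S - T) + card T" if "S \<in> bases" "T \<subseteq> S" for S
  proof -
    have "S - T \<union> T = S" using that by auto
    then have "S - T \<in> Q.bases" using bases_contract[OF TE rT, of "S - T"] that basis_subset by auto
    then show ?thesis using lift[of "S - T"] \<open>S - T \<union> T = S\<close> by simp
  qed
  have edge1: "y (Some i) = y (Some j)" if "S \<in> Q.bases" "card S \<le> m" "i \<in> S" "j \<in> S" "i \<noteq> j" for i j S
  proof (rule edge)
    show "0 < partial (add_mset (Some i) (add_mset (Some j) \<alpha>))"
    proof (subst partial_pos_iff)
      show "(\<forall>l. count (add_mset (Some i) (add_mset (Some j) \<alpha>)) (Some l) \<le> 1) \<and>
        (\<exists>S\<in>bases. elems (add_mset (Some i) (add_mset (Some j) \<alpha>)) \<subseteq> S \<and>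
          count (add_mset (Some i) (add_mset (Some j) \<alpha>)) None + card S \<le> card E)"
        using lift[OF that(1)] that affine cnt0 kT \<alpha>(2)
        by (intro conjI bexI[of _ "S \<union> T"]) (auto simp: elems_def T_def k_def m_def)
    qed (use \<alpha> lift[OF that(1)] that in \<open>auto simp: vars_def\<close>)
  qed (use lift[OF that(1)] that in \<open>auto simp: vars_def\<close>)
  have edge2: "y None = y (Some i)" if "S \<in> Q.bases" "card S < m" "i \<in> S" for i S
  proof (rule edge)
    show "0 < partial (add_mset None (add_mset (Some i) \<alpha>))"
    proof (subst partial_pos_iff)
      show "(\<forall>l. count (add_mset None (add_mset (Some i) \<alpha>)) (Some l) \<le> 1) \<and>
        (\<exists>S\<in>bases. elems (add_mset None (add_mset (Some i) \<alpha>)) \<subseteq> S \<and>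
          count (add_mset None (add_mset (Some i) \<alpha>)) None + card S \<le> card E)"
        using lift[OF that(1)] that affine cnt0 kT \<alpha>(2)
        by (intro conjI bexI[of _ "S \<union> T"]) (auto simp: elems_def T_def k_def m_def)
    qed (use \<alpha> lift[OF that(1)] that in \<open>auto simp: vars_def\<close>)
  qed (use lift[OF that(1)] that in \<open>auto simp: vars_def\<close>)
  have m2: "2 \<le> m" using \<alpha>(2) by (simp add: m_def)
  have vertex_Some: "\<exists>S\<in>Q.bases. i \<in> S \<and> card S \<le> m" if "0 < partial (add_mset (Some i) \<alpha>)" "i \<in> E" for i
  proof -
    have "set_mset (add_mset (Some i) \<alpha>) \<subseteq> vars" using \<alpha> that by (auto simp: vars_def)
    from that(1)[unfolded partial_pos_iff[OF this]] obtain S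
      where S: "S \<in> bases" "elems (add_mset (Some i) \<alpha>) \<subseteq> S" "k + card S \<le> card E"
        by (auto simp: k_def)
    have "count (add_mset (Some i) \<alpha>) (Some i) \<le> 1"
      using that(1)[unfolded partial_pos_iff[OF \<open>set_mset (add_mset (Some i) \<alpha>) \<subseteq> vars\<close>]] by blast
    with S have "i \<notin> T" "i \<in> S" "T \<subseteq> S" using cnt0[of i] by (auto simp: elems_def T_def)
    then show ?thesis
      using down[OF S(1)] S(3) kT \<alpha>(2) by (intro bexI[of _ "S - T"]) (auto simp: m_def)
  qed
  have vertex_None: "\<exists>S\<in>Q.bases. card S < m" if "0 < partial (add_mset None \<alpha>)"
  proof -
    have "set_mset (add_mset None \<alpha>) \<subseteq> vars" using \<alpha> by (auto simp: vars_def)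
    from that[unfolded partial_pos_iff[OF this]] obtain S
      where S: "S \<in> bases" "elems (add_mset None \<alpha>) \<subseteq> S" "Suc k + card S \<le> card E"
      by (auto simp: k_def)
    then have "T \<subseteq> S" by (auto simp: elems_def T_def)
    then show ?thesis
      using down[OF S(1)] S(3) kT \<alpha>(2) by (intro bexI[of _ "S - T"]) (auto simp: m_def)
  qed
  have None_Some: "y None = y (Some i)"
    if None: "0 < partial (add_mset None \<alpha>)" and Some: "0 < partial (add_mset (Some i) \<alpha>)" "i \<in> E" for i
  proof -
    obtain S where S: "S \<in> Q.bases" "card S < m" using vertex_None[OF None] by blast
    obtain Si where Si: "Si \<in> Q.bases" "i \<in> Si" using vertex_Some[OF Some] by blast
    show ?thesis
      by (rule Q.connected_to_homogenising_variable[where m = m and S = S and Si = Si, OF _ _ m2 S Si])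
        (blast intro: edge1 edge2)+
  qed
  have Some_Some: "y (Some i) = y (Some j)"
    if i: "0 < partial (add_mset (Some i) \<alpha>)" "i \<in> E" and j: "0 < partial (add_mset (Some j) \<alpha>)" "j \<in> E" for i j
  proof -
    obtain Si where Si: "Si \<in> Q.bases" "i \<in> Si" "card Si \<le> m" using vertex_Some[OF i] by blast
    obtain Sj where Sj: "Sj \<in> Q.bases" "j \<in> Sj" "card Sj \<le> m" using vertex_Some[OF j] by blast
    show ?thesis
      by (rule Q.connected[where m = m and Si = Si and Sj = Sj, OF _ _ m2 Si Sj]) (blast intro: edge1 edge2)+
  qed
  have in_E: "i \<in> E" if "Some i \<in> vars" for i using that by (auto simp: vars_def)
  show ?thesis
  proof (cases u; cases v)
    fix j assume "u = None" "v = Some j"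
    then show ?thesis using None_Some[of j] uv in_E by simp
  next
    fix i assume "u = Some i" "v = None"
    then show ?thesis using None_Some[of i] uv in_E by simp
  next
    fix i j assume "u = Some i" "v = Some j"
    then show ?thesis using Some_Some[of i j] uv in_E by simp
  qed simp
qed

text \<open>
  Unless the matrix is zero, the elements of \<open>\<alpha>\<close> form an independent set \<open>T\<close>. Its contraction leaves \<open>k + 2\<close> elements, where \<open>k\<close> is the multiplicity of the
  homogenising variable. Up to the weights, the matrix of second derivatives is the rank two link of the contraction.
\<close>

lemma partial_base:
  assumes \<alpha>: "set_mset \<alpha> \<subseteq> vars" "size \<alpha> + 2 = card E"
  shows "reverse_cauchy_schwarz vars (\<lambda>u v. partial (add_mset u (add_mset v \<alpha>)))"
proof (cases "\<exists>u\<in>vars. \<exists>v\<in>vars. 0 < partial (add_mset u (add_mset v \<alpha>))")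
  case False
  then have "partial (add_mset u (add_mset v \<alpha>)) = 0" if "u \<in> vars" "v \<in> vars" for u v
    using that partial_nonneg[of "add_mset u (add_mset v \<alpha>)"] by (force simp: less_le)
  then show ?thesis by (simp add: reverse_cauchy_schwarz_def bilin_def)
next
  case True
  then obtain u0 v0 where u0v0: "u0 \<in> vars" "v0 \<in> vars" "0 < partial (add_mset u0 (add_mset v0 \<alpha>))" by blast
  have "set_mset (add_mset u0 (add_mset v0 \<alpha>)) \<subseteq> vars" using u0v0 \<alpha> by auto
  from u0v0(3)[unfolded partial_pos_iff[OF this]] obtain S0
    where S0: "S0 \<in> bases" "elems (add_mset u0 (add_mset v0 \<alpha>)) \<subseteq> S0"
      and cnt: "\<And>i. count (add_mset u0 (add_mset v0 \<alpha>)) (Some i) \<le> 1" by blast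
  have affine: "count \<alpha> (Some i) \<le> 1" for i
    using cnt[of i] by (auto split: if_splits)
  define T where "T = elems \<alpha>"
  define k where "k = count \<alpha> None"
  have kT: "k + card T = size \<alpha>" and TE: "T \<subseteq> E"
    using card_elems[OF \<alpha>(1) affine] by (simp_all add: k_def T_def)
  have "T \<subseteq> S0" using S0 by (auto simp: T_def elems_def)
  then have rT: "r T = card T" using S0 M.independent_subset[of S0 T] by (auto simp: bases_def)
  interpret Q: matroid_quotient "E - T" "\<lambda>S. r (S \<union> T) - r T" "\<lambda>S. \<rho> (S \<union> T) - \<rho> T"
    by (rule contract_quotient[OF TE])
  have fT: "finite T" using TE fin finite_subset by blast
  have cardET: "card (E - T) = k + 2"
    using card_Diff_subset[OF fT TE] kT \<alpha>(2) by simp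
  define W where "W u = (case u of None \<Rightarrow> 1 | Some i \<Rightarrow> w i)" for u
  define \<kappa> where "\<kappa> = fact k * (\<Prod>i\<in>T. w i)"
  have \<kappa>: "0 \<le> \<kappa>" using weight_pos[OF TE] by (simp add: \<kappa>_def)
  define I where "I = insert None (Some ` (E - T))"
  have I: "I \<subseteq> vars" "finite I" using fin by (auto simp: I_def vars_def)
  have cnt0: "count \<alpha> (Some i) = (if i \<in> T then 1 else 0)" for i
    using affine[of i] count_eq_zero_iff[of \<alpha> "Some i"] by (auto simp: T_def elems_def le_Suc_eq)
  have base_iff: "S \<in> Q.bases \<longleftrightarrow> S \<union> T \<in> bases" if "S \<subseteq> E - T" for S
    by (rule bases_contract[OF TE rT that])
  have entry: "partial (add_mset u (add_mset v \<alpha>)) = \<kappa> * W u * W v * Q.rank_two_link k u v"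
    if "u \<in> I" "v \<in> I" for u v
  proof -
    have top: "set_mset (add_mset u (add_mset v \<alpha>)) \<subseteq> vars" "size (add_mset u (add_mset v \<alpha>)) = card E"
      using that I \<alpha> by auto
    have fact2: "fact (Suc (Suc k)) = (real (k + 2) * real (k + 1) * fact k :: real)"
      by (simp add: algebra_simps)
    have aff2: "(\<forall>l. count (add_mset u (add_mset v \<alpha>)) (Some l) \<le> 1) \<longleftrightarrow> (u = None \<or> u \<noteq> v)"
      using that by (auto simp: cnt0 I_def)
    have elems2: "elems (add_mset u (add_mset v \<alpha>)) = set_option u \<union> set_option v \<union> T"
      by (cases u; cases v) (auto simp: elems_def T_def)
    show ?thesis
    proof (cases u; cases v)
      assume uv: "u = None" "v = None"
      have "count (add_mset u (add_mset v \<alpha>)) None = Suc (Suc k)" using uv by (simp add: k_def)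
      then show ?thesis
        unfolding partial_top[OF top] aff2 elems2 fact2[symmetric]
        using uv base_iff[of "{}"] fact2 by (simp add: W_def \<kappa>_def)
    next
      fix j assume uv: "u = None" "v = Some j"
      then have j: "j \<in> E" "j \<notin> T" using that by (auto simp: I_def)
      have "count (add_mset u (add_mset v \<alpha>)) None = Suc k" using uv by (simp add: k_def)
      then show ?thesis
        unfolding partial_top[OF top] aff2 elems2
        using uv base_iff[of "{j}"] j fT by (simp add: W_def \<kappa>_def)
    next
      fix i assume uv: "u = Some i" "v = None"
      then have i: "i \<in> E" "i \<notin> T" using that by (auto simp: I_def)
      have "count (add_mset u (add_mset v \<alpha>)) None = Suc k" using uv by (simp add: k_def)
      then show ?thesis
        unfolding partial_top[OF top] aff2 elems2
        using uv base_iff[of "{i}"] i fT by (simp add: W_def \<kappa>_def)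
    next
      fix i j assume uv: "u = Some i" "v = Some j"
      then have ij: "i \<in> E" "i \<notin> T" "j \<in> E" "j \<notin> T" using that by (auto simp: I_def)
      have "count (add_mset u (add_mset v \<alpha>)) None = k" using uv by (simp add: k_def)
      then show ?thesis
        unfolding partial_top[OF top] aff2 elems2
        using uv base_iff[of "{i, j}"] ij fT by (auto simp: W_def \<kappa>_def insert_commute)
    qed
  qed
  \<comment> \<open>Variables in \<open>T\<close> occur to the first power only, so a second derivative by them vanishes.\<close>
  have out: "partial (add_mset u (add_mset v \<alpha>)) = 0" if "u \<in> vars" "v \<in> vars" "u \<notin> I \<or> v \<notin> I" for u v
  proof -
    have top: "set_mset (add_mset u (add_mset v \<alpha>)) \<subseteq> vars" "size (add_mset u (add_mset v \<alpha>)) = card E"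
      using that \<alpha> by auto
    have "\<exists>l\<in>T. u = Some l \<or> v = Some l"
      using that by (auto simp: I_def vars_def)
    then obtain l where "l \<in> T" "u = Some l \<or> v = Some l"
      by blast
    then have "2 \<le> count (add_mset u (add_mset v \<alpha>)) (Some l)" using cnt0[of l] by auto
    then have "\<not> count (add_mset u (add_mset v \<alpha>)) (Some l) \<le> 1" by simp
    then have "\<not> (\<forall>i. count (add_mset u (add_mset v \<alpha>)) (Some i) \<le> 1)" by blast
    then show ?thesis unfolding partial_top[OF top] by (simp only: simp_thms if_False)
  qed
  obtain c where c: "\<And>x. bilin I (Q.rank_two_link k) x x \<le> (\<Sum>u\<in>I. c u * x u)\<^sup>2"
    using Q.rank_two_link_le_square[OF cardET] unfolding I_def by blast
  show ?thesis
  proof (rule reverse_cauchy_schwarz_if_le_square[OF fin_vars])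
    fix x
    let ?A = "\<lambda>u v. partial (add_mset u (add_mset v \<alpha>))"
    have "bilin vars ?A x x = (\<Sum>u\<in>I. \<Sum>v\<in>vars. ?A u v * x u * x v)"
      unfolding bilin_def using I fin_vars out by (intro sum.mono_neutral_right) auto
    also have "\<dots> = (\<Sum>u\<in>I. \<Sum>v\<in>I. ?A u v * x u * x v)"
      using I fin_vars out by (intro sum.cong refl sum.mono_neutral_right) auto
    also have "\<dots> = \<kappa> * bilin I (Q.rank_two_link k) (\<lambda>u. W u * x u) (\<lambda>u. W u * x u)"
      unfolding bilin_def sum_distrib_left using entry by (intro sum.cong refl) (simp add: mult_ac)
    also have "\<dots> \<le> \<kappa> * (\<Sum>u\<in>I. c u * (W u * x u))\<^sup>2"
      by (intro mult_left_mono c \<kappa>)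
    also have "\<dots> = (\<Sum>u\<in>I. sqrt \<kappa> * c u * W u * x u)\<^sup>2"
    proof -
      have "(\<Sum>u\<in>I. sqrt \<kappa> * c u * W u * x u) = sqrt \<kappa> * (\<Sum>u\<in>I. c u * (W u * x u))"
        by (simp add: sum_distrib_left mult_ac)
      then show ?thesis using \<kappa> by (simp add: power_mult_distrib)
    qed
    also have "(\<Sum>u\<in>I. sqrt \<kappa> * c u * W u * x u) = (\<Sum>u\<in>vars. (if u \<in> I then sqrt \<kappa> * c u * W u else 0) * x u)"
      using I fin_vars by (intro sum.mono_neutral_cong_left) auto
    finally show "bilin vars ?A x x \<le> (\<Sum>u\<in>vars. (if u \<in> I then sqrt \<kappa> * c u * W u else 0) * x u)\<^sup>2" .
  qed (auto simp: partial_nonneg add_mset_commute)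
qed

lemma partial_reverse_cauchy_schwarz:
  assumes "set_mset \<alpha> \<subseteq> vars" "size \<alpha> + 2 \<le> card E"
  shows "reverse_cauchy_schwarz vars (\<lambda>u v. partial (add_mset u (add_mset v \<alpha>)))"
proof (rule reverse_cauchy_schwarz_local_to_global[OF fin_vars, where n = "card E"])
  fix \<alpha> y u v
  assume "set_mset \<alpha> \<subseteq> vars" "size \<alpha> + 2 \<le> card E"
    "\<And>i j. i \<in> vars \<Longrightarrow> j \<in> vars \<Longrightarrow> 0 < partial (add_mset i (add_mset j \<alpha>)) \<Longrightarrow> y i = (y j :: real)"
    "u \<in> vars" "v \<in> vars" "0 < partial (add_mset u \<alpha>)" "0 < partial (add_mset v \<alpha>)"
  then show "y u = y v" by (rule partial_connected)
qed (use assms partial_nonneg partial_euler partial_base in blast)+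

text \<open>
  With \<open>x i\<close> equal to the \<open>i\<close>-th coordinate of a direction divided by \<open>w i\<close>, the three sums are the
  second derivative in that direction, the value, and the first derivative of the generating
  polynomial at \<open>w\<close>.
\<close>

lemma log_concavity_inequality:
  fixes x :: "'a \<Rightarrow> real"
  shows "(\<Sum>S\<in>bases. (\<Prod>i\<in>S. w i) * ((\<Sum>i\<in>S. x i)\<^sup>2 - (\<Sum>i\<in>S. (x i)\<^sup>2))) * (\<Sum>S\<in>bases. \<Prod>i\<in>S. w i)
       \<le> (\<Sum>S\<in>bases. (\<Prod>i\<in>S. w i) * (\<Sum>i\<in>S. x i))\<^sup>2"
proof (cases "card E \<ge> 2")
  case False
  have "(\<Sum>i\<in>S. x i)\<^sup>2 - (\<Sum>i\<in>S. (x i)\<^sup>2) = 0" if "S \<in> bases" for S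
  proof -
    have "card S \<le> 1" using basis_card_le[OF that] False by simp
    moreover have "finite S" using basis_subset[OF that] fin finite_subset by blast
    ultimately have "S = {} \<or> (\<exists>i. S = {i})" by (auto simp: le_Suc_eq card_1_singleton_iff)
    then show ?thesis by auto
  qed
  then show ?thesis by simp
next
  case True
  define n where "n = real (card E)"
  have n: "2 \<le> n" using True by (simp add: n_def)
  define x' where "x' u = (case u of None \<Rightarrow> 0 | Some i \<Rightarrow> x i)" for u
  define \<mu> where "\<mu> S = (\<Prod>i\<in>S. w i)" for S
  define H0 where "H0 = (\<Sum>S\<in>bases. \<mu> S)"
  define H1 where "H1 = (\<Sum>S\<in>bases. \<mu> S * (\<Sum>i\<in>S. x i))"
  define H2 where "H2 = (\<Sum>S\<in>bases. \<mu> S * ((\<Sum>i\<in>S. x i)\<^sup>2 - (\<Sum>i\<in>S. (x i)\<^sup>2)))"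
  have fS: "finite S" if "S \<in> bases" for S using basis_subset[OF that] fin finite_subset by blast
  have sub: "(\<Sum>i\<in>E. if i \<in> S then f i else 0) = (\<Sum>i\<in>S. f i)" if "S \<in> bases" for S and f :: "'a \<Rightarrow> real"
    using basis_subset[OF that] fin by (simp add: sum.inter_restrict[symmetric] Int_absorb1)
  have Y0: "partial {#} = H0" by (simp add: partial_def scaled_derivative_def H0_def \<mu>_def)
  have Y1: "partial {#Some i#} = (\<Sum>S\<in>bases. if i \<in> S then \<mu> S else 0)" if "i \<in> E" for i
  proof -
    have "(\<Prod>u\<in>vars. falling_factorial (exponent S u) (count {#Some i#} u)) = (if i \<in> S then 1 else 0)" for S
    proof -
      have "(\<Prod>u\<in>vars. falling_factorial (exponent S u) (count {#Some i#} u))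
          = (\<Prod>u\<in>vars. if u = Some i then falling_factorial (exponent S (Some i)) 1 else 1)"
        by (intro prod.cong) auto
      also have "\<dots> = falling_factorial (exponent S (Some i)) 1"
        using fin_vars that by (subst prod.delta) (auto simp: vars_def)
      finally show ?thesis by (simp add: exponent_def falling_factorial_def)
    qed
    then show ?thesis unfolding partial_def scaled_derivative_def \<mu>_def by (intro sum.cong) auto
  qed
  have Y2: "partial {#Some i, Some j#} = (\<Sum>S\<in>bases. if i \<noteq> j \<and> i \<in> S \<and> j \<in> S then \<mu> S else 0)"
    if "i \<in> E" "j \<in> E" for i j
  proof -
    have "(\<Prod>u\<in>vars. falling_factorial (exponent S u) (count {#Some i, Some j#} u)) = (if i \<noteq> j \<and> i \<in> S \<and> j \<in> S then 1 else 0)" for S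
    proof (cases "i = j")
      case True
      have "falling_factorial (exponent S (Some i)) (count {#Some i, Some j#} (Some i)) = 0"
        using True by (intro falling_factorial_eq_0) (simp add: exponent_def)
      then show ?thesis using True fin_vars that by (auto intro!: prod_zero simp: vars_def)
    next
      case False
      have "(\<Prod>u\<in>vars. falling_factorial (exponent S u) (count {#Some i, Some j#} u))
          = (\<Prod>u\<in>vars. (if u = Some i then falling_factorial (exponent S (Some i)) 1 else 1) * (if u = Some j then falling_factorial (exponent S (Some j)) 1 else 1))"
        using False by (intro prod.cong) auto
      also have "\<dots> = falling_factorial (exponent S (Some i)) 1 * falling_factorial (exponent S (Some j)) 1"
        unfolding prod.distrib using fin_vars that by (subst (1 2) prod.delta) (auto simp: vars_def)
      finally show ?thesis using False by (simp add: exponent_def falling_factorial_def)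
    qed
    then show ?thesis unfolding partial_def scaled_derivative_def \<mu>_def by (intro sum.cong) auto
  qed
  have row: "(\<Sum>v\<in>vars. partial {#v, u#}) = (n - 1) * partial {#u#}" if "u \<in> vars" for u
    using partial_euler[of "{#u#}"] that True by (simp add: n_def of_nat_diff)
  have row0: "(\<Sum>u\<in>vars. partial {#u#}) = n * partial {#}"
    using partial_euler[of "{#}"] by (simp add: n_def)
  have total: "(\<Sum>u\<in>vars. \<Sum>v\<in>vars. partial {#u, v#}) = (n - 1) * n * H0"
  proof -
    have "(\<Sum>u\<in>vars. \<Sum>v\<in>vars. partial {#u, v#}) = (\<Sum>v\<in>vars. (n - 1) * partial {#v#})"
      by (subst sum.swap) (simp add: row)
    then show ?thesis by (simp add: sum_distrib_left[symmetric] row0 Y0)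
  qed
  have linear: "(\<Sum>u\<in>vars. \<Sum>v\<in>vars. partial {#u, v#} * x' v) = (n - 1) * H1"
  proof -
    have "(\<Sum>u\<in>vars. \<Sum>v\<in>vars. partial {#u, v#} * x' v) = (\<Sum>v\<in>vars. (n - 1) * (partial {#v#} * x' v))"
      by (subst sum.swap) (simp add: row sum_distrib_right[symmetric] mult.assoc)
    also have "\<dots> = (n - 1) * (\<Sum>i\<in>E. partial {#Some i#} * x i)"
      unfolding sum_distrib_left[symmetric] sum_vars by (simp add: x'_def)
    also have "(\<Sum>i\<in>E. partial {#Some i#} * x i) = (\<Sum>i\<in>E. \<Sum>S\<in>bases. if i \<in> S then \<mu> S * x i else 0)"
      by (intro sum.cong refl) (auto simp: Y1 sum_distrib_right intro!: sum.cong)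
    also have "\<dots> = H1"
      unfolding H1_def sum_distrib_left by (subst sum.swap) (intro sum.cong refl sub)
    finally show ?thesis .
  qed
  have quadratic: "bilin vars (\<lambda>u v. partial {#u, v#}) x' x' = H2"
  proof -
    have "bilin vars (\<lambda>u v. partial {#u, v#}) x' x' = (\<Sum>i\<in>E. \<Sum>j\<in>E. partial {#Some i, Some j#} * x i * x j)"
      unfolding bilin_def sum_vars by (simp add: x'_def)
    also have "\<dots> = (\<Sum>i\<in>E. \<Sum>j\<in>E. \<Sum>S\<in>bases. if i \<noteq> j \<and> i \<in> S \<and> j \<in> S then \<mu> S * (x i * x j) else 0)"
      by (intro sum.cong refl) (auto simp: Y2 sum_distrib_right mult.assoc intro!: sum.cong)
    also have "\<dots> = (\<Sum>S\<in>bases. \<Sum>i\<in>E. \<Sum>j\<in>E. if i \<noteq> j \<and> i \<in> S \<and> j \<in> S then \<mu> S * (x i * x j) else 0)"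
      by (rule trans[OF sum.cong[OF refl sum.swap] sum.swap])
    also have "\<dots> = H2"
      unfolding H2_def
    proof (intro sum.cong refl)
      fix S assume S: "S \<in> bases"
      have "(\<Sum>i\<in>E. \<Sum>j\<in>E. if i \<noteq> j \<and> i \<in> S \<and> j \<in> S then \<mu> S * (x i * x j) else 0)
          = (\<Sum>i\<in>E. if i \<in> S then \<mu> S * (x i * ((\<Sum>j\<in>S. x j) - x i)) else 0)"
      proof (intro sum.cong refl)
        fix i assume "i \<in> E"
        show "(\<Sum>j\<in>E. if i \<noteq> j \<and> i \<in> S \<and> j \<in> S then \<mu> S * (x i * x j) else 0)
            = (if i \<in> S then \<mu> S * (x i * ((\<Sum>j\<in>S. x j) - x i)) else 0)"
        proof (cases "i \<in> S")
          case True
          have "(\<Sum>j\<in>E. if i \<noteq> j \<and> i \<in> S \<and> j \<in> S then \<mu> S * (x i * x j) else 0)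
              = (\<Sum>j\<in>E. if j \<in> S then (if i \<noteq> j then \<mu> S * (x i * x j) else 0) else 0)"
            using True by (intro sum.cong) auto
          also have "\<dots> = (\<Sum>j\<in>S. if i \<noteq> j then \<mu> S * (x i * x j) else 0)" by (rule sub[OF S])
          also have "\<dots> = (\<Sum>j\<in>S - {i}. \<mu> S * (x i * x j))"
            using fS[OF S] by (intro sum.mono_neutral_cong_right) auto
          also have "\<dots> = \<mu> S * (x i * (\<Sum>j\<in>S - {i}. x j))" by (simp add: sum_distrib_left)
          also have "(\<Sum>j\<in>S - {i}. x j) = (\<Sum>j\<in>S. x j) - x i"
            using True fS[OF S] by (simp add: sum_diff1)
          finally show ?thesis using True by simp
        qed simp
      qed
      also have "\<dots> = (\<Sum>i\<in>S. \<mu> S * (x i * ((\<Sum>j\<in>S. x j) - x i)))" by (rule sub[OF S])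
      also have "\<dots> = \<mu> S * ((\<Sum>i\<in>S. x i)\<^sup>2 - (\<Sum>i\<in>S. (x i)\<^sup>2))"
        by (simp add: power2_eq_square right_diff_distrib sum_subtractf sum_distrib_left sum_distrib_right mult_ac)
      finally show "(\<Sum>i\<in>E. \<Sum>j\<in>E. if i \<noteq> j \<and> i \<in> S \<and> j \<in> S then \<mu> S * (x i * x j) else 0)
          = \<mu> S * ((\<Sum>i\<in>S. x i)\<^sup>2 - (\<Sum>i\<in>S. (x i)\<^sup>2))" .
    qed
    finally show ?thesis .
  qed
  have "H2 * ((n - 1) * n * H0) \<le> ((n - 1) * H1)\<^sup>2"
    using reverse_cauchy_schwarzD[OF partial_reverse_cauchy_schwarz[of "{#}"], of x'] True
    unfolding quadratic total linear by simp
  then have "(n - 1) * (n * (H2 * H0)) \<le> (n - 1) * ((n - 1) * H1\<^sup>2)"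
    by (simp add: power2_eq_square algebra_simps)
  then have "n * (H2 * H0) \<le> (n - 1) * H1\<^sup>2" using n by simp
  also have "\<dots> \<le> n * H1\<^sup>2" by (intro mult_right_mono) auto
  finally have "H2 * H0 \<le> H1\<^sup>2" using n by simp
  then show ?thesis by (simp add: H0_def H1_def H2_def \<mu>_def)
qed

end

section \<open>Concavity along segments\<close>

context matroid_quotient
begin

definition generating_poly :: "('a \<Rightarrow> real) \<Rightarrow> real" where
  "generating_poly w = (\<Sum>S\<in>bases. \<Prod>i\<in>S. w i)"

lemma generating_poly_pos:
  assumes "bases \<noteq> {}" "\<And>i. i \<in> E \<Longrightarrow> 0 < w i"
  shows "0 < generating_poly w"
  unfolding generating_poly_def using assms finite_bases
  by (intro sum_pos prod_pos) (auto simp: bases_def)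

text \<open>
  Along a line, the logarithmic derivative of a monomial is the sum of the quantities \<open>x t i\<close>, whose derivatives are
  \<open>- (x t i)\<^sup>2\<close>. So the first two derivatives of the polynomial are the sums in the preceding
  inequality, taken at the weights of the current point.
\<close>

lemma concave_on_segment:
  fixes a d :: "'a \<Rightarrow> real"
  assumes ne: "bases \<noteq> {}" and pos: "\<And>i t. i \<in> E \<Longrightarrow> t \<in> {0..1} \<Longrightarrow> 0 < a i + t * d i"
  shows "concave_on {0..1} (\<lambda>t. ln (generating_poly (\<lambda>i. a i + t * d i)))"
proof (rule f''_le0_imp_concave)
  define p where "p i t = a i + t * d i" for i t
  define x where "x t i = d i / p i t" for t i
  define H0 where "H0 t = (\<Sum>S\<in>bases. \<Prod>i\<in>S. p i t)" for t
  define H1 where "H1 t = (\<Sum>S\<in>bases. (\<Prod>i\<in>S. p i t) * (\<Sum>i\<in>S. x t i))" for t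
  define H2 where "H2 t = (\<Sum>S\<in>bases. (\<Prod>i\<in>S. p i t) * ((\<Sum>i\<in>S. x t i)\<^sup>2 - (\<Sum>i\<in>S. (x t i)\<^sup>2)))" for t
  have H0_eq: "generating_poly (\<lambda>i. a i + t * d i) = H0 t" for t
    by (simp add: generating_poly_def H0_def p_def)
  have ppos: "0 < p i t" if "i \<in> S" "S \<in> bases" "t \<in> {0..1}" for i S t
    using pos that by (auto simp: p_def bases_def)
  have H0_pos: "0 < H0 t" if "t \<in> {0..1}" for t
    using generating_poly_pos[OF ne, of "\<lambda>i. a i + t * d i"] pos that H0_eq by simp
  have dp: "(p i has_real_derivative d i) (at t)" for i t
    unfolding p_def by (auto intro!: derivative_eq_intros)
  have dprod: "((\<lambda>t. \<Prod>i\<in>S. p i t) has_real_derivative (\<Prod>i\<in>S. p i t) * (\<Sum>i\<in>S. x t i)) (at t)"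
    if "S \<in> bases" "t \<in> {0..1}" for S t
    unfolding x_def using ppos[OF _ that] dp by (intro has_field_derivative_prod') (auto simp: less_imp_neq[symmetric])
  have dx: "((\<lambda>t. x t i) has_real_derivative - (x t i)\<^sup>2) (at t)" if "i \<in> S" "S \<in> bases" "t \<in> {0..1}" for i S t
    unfolding x_def using ppos[OF that]
    by (auto intro!: derivative_eq_intros dp simp: power2_eq_square)
  have d0: "(H0 has_real_derivative H1 t) (at t)" if "t \<in> {0..1}" for t
    unfolding H0_def H1_def using dprod that by (intro DERIV_sum) auto
  have d1: "(H1 has_real_derivative H2 t) (at t)" if "t \<in> {0..1}" for t
    unfolding H1_def H2_def
  proof (intro DERIV_sum)
    fix S assume S: "S \<in> bases"
    have "((\<lambda>t. \<Sum>i\<in>S. x t i) has_real_derivative (\<Sum>i\<in>S. - (x t i)\<^sup>2)) (at t)"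
      using dx S that by (intro DERIV_sum) auto
    from DERIV_mult[OF dprod[OF S that] this]
    show "((\<lambda>t. (\<Prod>i\<in>S. p i t) * (\<Sum>i\<in>S. x t i)) has_real_derivative
       (\<Prod>i\<in>S. p i t) * ((\<Sum>i\<in>S. x t i)\<^sup>2 - (\<Sum>i\<in>S. (x t i)\<^sup>2))) (at t)"
      by (simp add: sum_negf power2_eq_square algebra_simps)
  qed
  show "convex {0..1::real}" by simp
  show "((\<lambda>t. ln (generating_poly (\<lambda>i. a i + t * d i))) has_real_derivative H1 t / H0 t) (at t)"
    if "t \<in> {0..1}" for t
    unfolding H0_eq using d0[OF that] H0_pos[OF that]
    by (auto intro!: derivative_eq_intros)
  show "((\<lambda>t. H1 t / H0 t) has_real_derivative (H2 t * H0 t - H1 t * H1 t) / (H0 t * H0 t)) (at t)"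
    if "t \<in> {0..1}" for t
    using d0[OF that] d1[OF that] H0_pos[OF that] by (intro DERIV_divide) auto
  show "(H2 t * H0 t - H1 t * H1 t) / (H0 t * H0 t) \<le> 0" if "t \<in> {0..1}" for t
  proof -
    interpret weighted_matroid_quotient E r \<rho> "\<lambda>i. p i t"
      using pos that by unfold_locales (auto simp: p_def)
    have "H2 t * H0 t \<le> (H1 t)\<^sup>2"
      unfolding H0_def H1_def H2_def by (rule log_concavity_inequality)
    then show ?thesis by (intro divide_nonpos_nonneg) (auto simp: power2_eq_square)
  qed
qed

end

section \<open>Morphisms of matroids\<close>

lemma (in matroid) contained_in_basis_iff:
  "S \<subseteq> E \<Longrightarrow> (\<exists>A. matroid_basis E rk A \<and> S \<subseteq> A) \<longleftrightarrow> rk S = card S"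
  unfolding matroid_basis_def
  by (metis independent_extend independent_subset order_refl)

lemma (in matroid) contains_basis_iff:
  assumes "S \<subseteq> E"
  shows "(\<exists>B. matroid_basis E rk B \<and> B \<subseteq> S) \<longleftrightarrow> rk S = rk E"
proof
  assume "\<exists>B. matroid_basis E rk B \<and> B \<subseteq> S"
  then obtain B where "B \<subseteq> S" "rk B = rk E" by (auto simp: matroid_basis_def)
  then show "rk S = rk E" using rk_mono[of B S] rk_mono[of S E] assms by simp
next
  assume "rk S = rk E"
  moreover obtain B where "B \<subseteq> S" "rk B = card B" "card B = rk S"
    using independent_extend[of "{}" S] assms by auto
  ultimately show "\<exists>B. matroid_basis E rk B \<and> B \<subseteq> S"
    using assms by (intro exI[of _ B]) (auto simp: matroid_basis_def)
qed

text \<open>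
  Images commute with unions, and the image of an intersection is contained in the intersection of
  the images; by monotonicity this is enough for submodularity.
\<close>

lemma matroid_pullback:
  assumes "finite E" "matroid F rkN" and f: "f \<in> E \<rightarrow> F"
  shows "matroid E (\<lambda>S. rkN (f ` S))"
proof -
  interpret N: matroid F rkN by fact
  have sub: "f ` S \<subseteq> F" if "S \<subseteq> E" for S using f that by auto
  show ?thesis
  proof
    show "finite E" by fact
    show "rkN (f ` S) \<le> card S" if "S \<subseteq> E" for S
      using N.rk_le_card[OF sub[OF that]] card_image_le[of S f] finite_subset[OF that \<open>finite E\<close>]
      by linarith
    show "rkN (f ` S) \<le> rkN (f ` T)" if "S \<subseteq> T" "T \<subseteq> E" for S T
      using that sub by (intro N.rk_mono) auto
    show "rkN (f ` (S \<union> T)) + rkN (f ` (S \<inter> T)) \<le> rkN (f ` S) + rkN (f ` T)" if "S \<subseteq> E" "T \<subseteq> E" for S T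
    proof -
      have "rkN (f ` (S \<inter> T)) \<le> rkN (f ` S \<inter> f ` T)"
        using sub[OF that(1)] by (intro N.rk_mono) auto
      then show ?thesis
        using N.rk_submodular[OF sub[OF that(1)] sub[OF that(2)]] by (simp add: image_Un)
    qed
  qed
qed

lemma matroid_quotient_pullback:
  assumes "matroid E rkM" "matroid F rkN" "matroid_morphism E rkM F rkN f"
  shows "matroid_quotient E rkM (\<lambda>S. rkN (f ` S))"
proof -
  interpret M: matroid E rkM by fact
  have f: "f \<in> E \<rightarrow> F"
    and le: "\<And>A B. A \<subseteq> B \<Longrightarrow> B \<subseteq> E \<Longrightarrow> int (rkN (f ` B)) - int (rkN (f ` A)) \<le> int (rkM B) - int (rkM A)"
    using assms(3) by (auto simp: matroid_morphism_def)
  interpret N: matroid E "\<lambda>S. rkN (f ` S)" by (rule matroid_pullback[OF M.finite_ground assms(2) f])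
  show ?thesis
  proof
    show "rkN (f ` B) + rkM A \<le> rkM B + rkN (f ` A)" if "A \<subseteq> B" "B \<subseteq> E" for A B
      using le[OF that] by linarith
  qed
qed

text \<open>
  In general the image of \<open>E\<close> need not span \<open>N\<close>, and then there are no bases of the morphism, whereas the
  pulled back quotient always has some. One basis is enough to exclude this.
\<close>

lemma morphism_bases_eq_bases:
  assumes "matroid E rkM" "matroid F rkN" "matroid_morphism E rkM F rkN f"
    and ne: "morphism_bases E rkM F rkN f \<noteq> {}"
  shows "morphism_bases E rkM F rkN f = matroid_quotient.bases E rkM (\<lambda>S. rkN (f ` S))"
proof -
  interpret Q: matroid_quotient E rkM "\<lambda>S. rkN (f ` S)" by (rule matroid_quotient_pullback) fact+
  interpret N: matroid F rkN by fact
  have f: "f ` S \<subseteq> F" if "S \<subseteq> E" for S using assms(3) that by (auto simp: matroid_morphism_def)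
  have char: "S \<in> morphism_bases E rkM F rkN f \<longleftrightarrow> S \<subseteq> E \<and> rkM S = card S \<and> rkN (f ` S) = rkN F" for S
    unfolding morphism_bases_def using Q.M.contained_in_basis_iff N.contains_basis_iff f by blast
  obtain S0 where S0: "S0 \<in> morphism_bases E rkM F rkN f" using ne by blast
  then have "rkN F \<le> rkN (f ` E)" using char Q.N.rk_mono[of S0 E] by auto
  then have "rkN (f ` E) = rkN F" using N.rk_mono[OF f[of E]] by simp
  then show ?thesis using char by (auto simp: Q.bases_def)
qed

lemma lookup_scaleR_poly_mapping [simp]:
  "Poly_Mapping.lookup (c *\<^sub>R x) i = c *\<^sub>R Poly_Mapping.lookup x i"
proof -
  have "finite {i. c *\<^sub>R Poly_Mapping.lookup x i \<noteq> 0}"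
    by (rule finite_subset[of _ "Poly_Mapping.keys x"]) (auto simp: in_keys_iff)
  then show ?thesis unfolding scaleR_poly_mapping_def by (simp add: lookup_Abs_poly_mapping)
qed

lemma convex_combination_pos:
  fixes a b u v :: real
  assumes "0 < a" "0 < b" "0 \<le> u" "0 \<le> v" "u + v = 1"
  shows "0 < u * a + v * b"
  using assms by (cases "u = 0") (auto simp: add_pos_nonneg)

lemma convex_positive_orthant: "convex (positive_orthant E)"
proof (rule convexI)
  fix x y :: "'a \<Rightarrow>\<^sub>0 real" and u v :: real
  assume *: "x \<in> positive_orthant E" "y \<in> positive_orthant E" "0 \<le> u" "0 \<le> v" "u + v = 1"
  have "Poly_Mapping.lookup (u *\<^sub>R x + v *\<^sub>R y) i = 0" if "i \<notin> E" for i
  proof -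
    have "Poly_Mapping.lookup x i = 0" "Poly_Mapping.lookup y i = 0"
      using *(1,2) that by (auto simp: positive_orthant_def coord_space_def simp flip: not_in_keys_iff_lookup_eq_zero)
    then show ?thesis by (simp add: lookup_add)
  qed
  then have "Poly_Mapping.keys (u *\<^sub>R x + v *\<^sub>R y) \<subseteq> E" by (auto simp: in_keys_iff)
  moreover have "0 < Poly_Mapping.lookup (u *\<^sub>R x + v *\<^sub>R y) i" if "i \<in> E" for i
    using * that by (simp add: positive_orthant_def lookup_add convex_combination_pos)
  ultimately show "u *\<^sub>R x + v *\<^sub>R y \<in> positive_orthant E"
    by (simp add: positive_orthant_def coord_space_def)
qed

theorem theorem1p2:
  fixes E :: "'a set" and rkM :: "'a set \<Rightarrow> nat"
    and F :: "'b set" and rkN :: "'b set \<Rightarrow> nat"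
    and f :: "'a \<Rightarrow> 'b"
  assumes "matroid E rkM"
    and "matroid F rkN"
    and "matroid_morphism E rkM F rkN f"
  shows "(\<forall>w\<in>coord_space E. basis_gen_poly E rkM F rkN f w = 0) \<or>
         concave_on (positive_orthant E) (\<lambda>w. ln (basis_gen_poly E rkM F rkN f w))"
proof (cases "morphism_bases E rkM F rkN f = {}")
  case True
  then show ?thesis by (simp add: basis_gen_poly_def)
next
  case False
  interpret Q: matroid_quotient E rkM "\<lambda>S. rkN (f ` S)" by (rule matroid_quotient_pullback) fact+
  have bases: "morphism_bases E rkM F rkN f = Q.bases"
    by (rule morphism_bases_eq_bases) fact+
  have gen: "basis_gen_poly E rkM F rkN f w = Q.generating_poly (Poly_Mapping.lookup w)" for w
    by (simp add: basis_gen_poly_def Q.generating_poly_def bases)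
  have "concave_on (positive_orthant E) (\<lambda>w. ln (basis_gen_poly E rkM F rkN f w))"
    unfolding concave_on_iff
  proof (intro conjI ballI allI impI convex_positive_orthant)
    fix x y :: "'a \<Rightarrow>\<^sub>0 real" and u v :: real
    assume xy: "x \<in> positive_orthant E" "y \<in> positive_orthant E" and uv: "0 \<le> u" "0 \<le> v" "u + v = 1"
    define a where "a = Poly_Mapping.lookup x"
    define d where "d i = Poly_Mapping.lookup y i - Poly_Mapping.lookup x i" for i
    define g where "g t = ln (Q.generating_poly (\<lambda>i. a i + t * d i))" for t
    have "concave_on {0..1} g"
      unfolding g_def
    proof (rule Q.concave_on_segment)
      show "Q.bases \<noteq> {}" using False bases by simp
      show "0 < a i + t * d i" if "i \<in> E" "t \<in> {0..1}" for i t
      proof -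
        have "0 < (1 - t) * Poly_Mapping.lookup x i + t * Poly_Mapping.lookup y i"
          using xy that by (intro convex_combination_pos) (auto simp: positive_orthant_def)
        then show ?thesis by (simp add: a_def d_def algebra_simps)
      qed
    qed
    then have "(1 - v) * g 0 + v * g 1 \<le> g ((1 - v) *\<^sub>R 0 + v *\<^sub>R 1)"
      by (rule concave_onD) (use uv in auto)
    moreover have u: "u = 1 - v" using uv by simp
    ultimately have "u * g 0 + v * g 1 \<le> g v" by simp
    moreover have "a i + v * d i = Poly_Mapping.lookup (u *\<^sub>R x + v *\<^sub>R y) i" for i
      unfolding u lookup_add lookup_scaleR_poly_mapping a_def d_def by (simp add: algebra_simps)
    ultimately show "u * ln (basis_gen_poly E rkM F rkN f x) + v * ln (basis_gen_poly E rkM F rkN f y)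
        \<le> ln (basis_gen_poly E rkM F rkN f (u *\<^sub>R x + v *\<^sub>R y))"
      unfolding gen by (simp add: g_def a_def d_def)
  qed
  then show ?thesis ..
qed

end
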